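(* Let $E$ be a complex Banach space, let $I=\mathbb{R}$ or $I=[0,\infty)$, and let $c\in\mathbb{C}$ with $|c|=1$. Denote by $AP_{c,0}(I:E)$ the linear span of the set of all $c$-almost periodic functions $I\to E$, and by $\mathbf{AP}_{c,0}(I:E)$ the closure of $AP_{c,0}(I:E)$ in $AP(I:E)$. Then the following holds: (i) If $\arg(c)\in\pi\cdot\mathbb{Q}$, then $\mathbf{AP}_{c,0}(I:E)=AP_{\mathbb{R}\setminus\{0\}}(I:E)$. (ii) If $\arg(c)\notin\pi\cdot\mathbb{Q}$, then $\mathbf{AP}_{c,0}(I:E)\supseteq AP_{\mathbb{R}\setminus\{0\}}(I:E)$.
   Context: A continuous function $f:I\to E$ is $c$-almost periodic if for each $\epsilon>0$ the set of all $\tau>0$ such that $\|f(t+\tau)-cf(t)\|\le\epsilon$ for all $t\in I$ is relatively dense in $[0,\infty)$, i.e. there exists $l>0$ such that every subinterval of $[0,\infty)$ of length $l$ meets this set. Almost periodic means $c$-almost periodic with $c=1$; $AP(I:E)$ denotes the Banach space of all almost periodic functions $I\to E$ with the sup-norm. Every $c$-almost periodic function ($|c|=1$) is almost periodic, so that $AP_{c,0}(I:E)\subseteq AP(I:E)$. For $f\in AP(I:E)$ and $r\in\mathbb{R}$ the Bohr-Fourier coefficient $P_r(f):=\lim_{t\to\infty}\frac1t\int_0^t e^{-irs}f(s)\,ds$ exists; put $\sigma(f):=\{r\in\mathbb{R}:P_r(f)\neq0\}$. For non-empty $\Lambda\subseteq\mathbb{R}$, $AP_\Lambda(I:E):=\{f\in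 AP(I:E):\sigma(f)\subseteq\Lambda\}$.
   Formalization: Part (i) is stated with the added condition c ≠ 1: for c = 1 (arg(c) = 0) and E ≠ {0} it is false, since nonzero constant functions are almost periodic but have nonzero Bohr-Fourier coefficient at 0. *)

theory Defs
  imports "HOL-Analysis.Analysis" "HOL-Library.Function_Algebras"
begin

section \<open>Complex Banach spaces\<close>

class complex_banach = banach +
  fixes scaleC :: "complex \<Rightarrow> 'a \<Rightarrow> 'a"  (infixr \<open>*\<^sub>C\<close> 75)
  assumes scaleC_add_right: "a *\<^sub>C (x + y) = a *\<^sub>C x + a *\<^sub>C y"
    and scaleC_add_left: "(a + b) *\<^sub>C x = a *\<^sub>C x + b *\<^sub>C x"
    and scaleC_scaleC: "a *\<^sub>C (b *\<^sub>C x) = (a * b) *\<^sub>C x"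
    and scaleC_of_real: "complex_of_real r *\<^sub>C x = r *\<^sub>R x"
    and norm_scaleC: "norm (a *\<^sub>C x) = cmod a * norm x"

lemma scaleC_one: "1 *\<^sub>C x = (x :: 'a :: complex_banach)"
  using scaleC_of_real[of 1 x] by simp

instantiation complex :: complex_banach
begin

definition scaleC_complex :: "complex \<Rightarrow> complex \<Rightarrow> complex"
  where "scaleC_complex = (*)"

instance
  by standard (simp_all add: scaleC_complex_def algebra_simps norm_mult scaleR_conv_of_real)

end

text \<open>Pointwise complex vector space structure on functions; \<open>cfun.span\<close> is the complex linear span.\<close>

global_interpretation cfun: vector_space
  "\<lambda>(a :: complex) (f :: real \<Rightarrow> 'e :: complex_banach) t. a *\<^sub>C f t"
  by standard
    (simp_all add: fun_eq_iff scaleC_add_right scaleC_add_left scaleC_scaleC scaleC_one)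


section \<open>Almost periodic functions\<close>

text \<open>
  Here \<open>I\<close> is \<open>\<real>\<close> or \<open>[0,\<infinity>)\<close>. A function \<open>I \<rightarrow> E\<close> is represented by its extension by zero to
  \<open>\<real>\<close>. These extensions form a complex linear space, and two of them are equal exactly when the
  functions agree on \<open>I\<close>.
\<close>

definition relatively_dense :: "real set \<Rightarrow> bool"
  where "relatively_dense S \<longleftrightarrow> (\<exists>l>0. \<forall>a\<ge>0. {a..a + l} \<inter> S \<noteq> {})"

definition c_almost_periodic :: "complex \<Rightarrow> real set \<Rightarrow> (real \<Rightarrow> 'e :: complex_banach) \<Rightarrow> bool"
  where "c_almost_periodic c I f \<longleftrightarrow>
    (\<forall>t. t \<notin> I \<longrightarrow> f t = 0) \<and> continuous_on I f \<and>
    (\<forall>\<epsilon>>0. relatively_dense {\<tau>. \<tau> > 0 \<and> (\<forall>t\<in>I. norm (f (t + \<tau>) - c *\<^sub>C f t) \<le> \<epsilon>)})"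

definition AP :: "real set \<Rightarrow> (real \<Rightarrow> 'e :: complex_banach) set"
  where "AP I = {f. c_almost_periodic 1 I f}"

text \<open>
  The sup-norm distance on \<open>AP I\<close>. It is set to zero for arguments outside \<open>AP I\<close>, because the
  locale \<open>Metric_space\<close> requires nonnegativity and symmetry on the whole type.
\<close>

definition AP_dist :: "real set \<Rightarrow> (real \<Rightarrow> 'e :: complex_banach) \<Rightarrow> (real \<Rightarrow> 'e) \<Rightarrow> real"
  where "AP_dist I f g =
    (if f \<in> AP I \<and> g \<in> AP I then SUP t\<in>I. norm (f t - g t) else 0)"

abbreviation AP_topology :: "real set \<Rightarrow> (real \<Rightarrow> 'e :: complex_banach) topology"
  where "AP_topology I \<equiv> Metric_space.mtopology (AP I) (AP_dist I)"

lemma AP_bounded: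
  fixes f :: "real \<Rightarrow> 'e :: complex_banach"
  assumes I: "I = UNIV \<or> I = {0..}" and f: "f \<in> AP I"
  shows "\<exists>B. \<forall>t\<in>I. norm (f t) \<le> B"
proof -
  have f': "continuous_on I f \<and>
      (\<forall>\<epsilon>>0. relatively_dense {\<tau>. \<tau> > 0 \<and> (\<forall>t\<in>I. norm (f (t + \<tau>) - f t) \<le> \<epsilon>)})"
    using f unfolding AP_def c_almost_periodic_def mem_Collect_eq scaleC_one by blast
  then have cont: "continuous_on I f" ..
  have per: "relatively_dense {\<tau>. \<tau> > 0 \<and> (\<forall>t\<in>I. norm (f (t + \<tau>) - f t) \<le> 1)}"
    using conjunct2[OF f', THEN spec, of 1] by simp
  from per obtain l where l: "l > 0"
    and ne: "\<forall>a\<ge>0. {a..a + l} \<inter>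
      {\<tau>. \<tau> > 0 \<and> (\<forall>t\<in>I. norm (f (t + \<tau>) - f t) \<le> 1)} \<noteq> {}"
    unfolding relatively_dense_def by (elim exE conjE)
  have "continuous_on {0..l} f"
    using cont by (rule continuous_on_subset) (use I in auto)
  then have "bounded (f ` {0..l})"
    by (intro compact_imp_bounded compact_continuous_image) auto
  then obtain B where B: "\<And>s. s \<in> {0..l} \<Longrightarrow> norm (f s) \<le> B"
    unfolding bounded_iff by blast
  have "norm (f t) \<le> B + 1" if t: "t \<in> I" for t
  proof -
    consider "t \<ge> l" | "0 \<le> t" "t \<le> l" | "t < 0" by linarith
    then show ?thesis
    proof cases
      case 1
      then have "t - l \<ge> 0" by simp
      then obtain \<tau> where \<tau>: "\<tau> \<in> {t - l..t - l + l}"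
        and le: "\<forall>s\<in>I. norm (f (s + \<tau>) - f s) \<le> 1"
        using ne by blast
      have "t - \<tau> \<in> I" using I \<tau> by auto
      with le have "norm (f (t - \<tau> + \<tau>) - f (t - \<tau>)) \<le> 1" by blast
      then have "norm (f t - f (t - \<tau>)) \<le> 1" by simp
      moreover have "norm (f (t - \<tau>)) \<le> B" using \<tau> by (intro B) auto
      ultimately show ?thesis
        using norm_triangle_sub[of "f t" "f (t - \<tau>)"] by linarith
    next
      case 2
      then show ?thesis using B[of t] by auto
    next
      case 3
      then have "- t \<ge> 0" by simp
      then obtain \<tau> where \<tau>: "\<tau> \<in> {- t..- t + l}"
        and le: "\<forall>s\<in>I. norm (f (s + \<tau>) - f s) \<le> 1"
        using ne by blast
      have "norm (f (t + \<tau>) - f t) \<le> 1" using le t by blast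
      moreover have "norm (f (t + \<tau>)) \<le> B" using \<tau> by (intro B) auto
      ultimately show ?thesis
        using norm_triangle_sub[of "f t" "f (t + \<tau>)"] norm_minus_commute[of "f t" "f (t + \<tau>)"]
        by linarith
    qed
  qed
  then show ?thesis by blast
qed

lemma Metric_space_AP:
  assumes I: "I = UNIV \<or> I = {0..}"
  shows "Metric_space (AP I :: (real \<Rightarrow> 'e :: complex_banach) set) (AP_dist I)"
proof
  have I0: "0 \<in> I" using I by auto
  have bdd: "bdd_above ((\<lambda>t. norm (f t - g t)) ` I)"
    if fg: "f \<in> AP I" "g \<in> AP I" for f g :: "real \<Rightarrow> 'e"
  proof -
    obtain B C where "\<forall>t\<in>I. norm (f t) \<le> B" "\<forall>t\<in>I. norm (g t) \<le> C"
      using AP_bounded[OF I fg(1)] AP_bounded[OF I fg(2)] by blast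
    then have "norm (f t - g t) \<le> B + C" if "t \<in> I" for t
      using that by (intro order_trans[OF norm_triangle_ineq4 add_mono]) auto
    then show ?thesis by (auto simp: bdd_above_def)
  qed
  have upper: "norm (f t - g t) \<le> AP_dist I f g"
    if fg: "f \<in> AP I" "g \<in> AP I" and t: "t \<in> I" for f g :: "real \<Rightarrow> 'e" and t
    using cSUP_upper[OF t bdd[OF fg]] fg by (simp add: AP_dist_def)
  fix x y z :: "real \<Rightarrow> 'e"
  show "0 \<le> AP_dist I x y"
  proof (cases "x \<in> AP I \<and> y \<in> AP I")
    case True
    then show ?thesis using upper[of x y 0] I0 norm_ge_zero order_trans by blast
  qed (auto simp: AP_dist_def)
  show "AP_dist I x y = AP_dist I y x"
    by (auto simp: AP_dist_def norm_minus_commute)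
  assume x: "x \<in> AP I" and y: "y \<in> AP I"
  have "x = y" if "AP_dist I x y = 0"
  proof
    fix t
    show "x t = y t"
      using upper[OF x y, of t] that x y
      by (cases "t \<in> I") (auto simp: AP_def c_almost_periodic_def)
  qed
  moreover have "AP_dist I x x = 0"
  proof -
    have "(\<lambda>t. norm (x t - x t)) ` I = {0}" using I0 by auto
    then have "(SUP t\<in>I. norm (x t - x t)) = 0" by (metis cSup_singleton)
    then show ?thesis using x by (simp only: AP_dist_def simp_thms if_True)
  qed
  ultimately show "AP_dist I x y = 0 \<longleftrightarrow> x = y" by blast
  assume z: "z \<in> AP I"
  have "(SUP t\<in>I. norm (x t - z t)) \<le> AP_dist I x y + AP_dist I y z"
  proof (rule cSUP_least)
    show "I \<noteq> {}" using I0 by blast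
    fix t assume t: "t \<in> I"
    have "norm (x t - z t) \<le> norm (x t - y t) + norm (y t - z t)"
      using norm_triangle_ineq[of "x t - y t" "y t - z t"] by simp
    then show "norm (x t - z t) \<le> AP_dist I x y + AP_dist I y z"
      using upper[OF x y t] upper[OF y z t] by linarith
  qed
  then show "AP_dist I x z \<le> AP_dist I x y + AP_dist I y z"
    using x z by (simp add: AP_dist_def[of I x z])
qed


section \<open>Spans of c-almost periodic functions and spectra\<close>

definition AP_c0 :: "complex \<Rightarrow> real set \<Rightarrow> (real \<Rightarrow> 'e :: complex_banach) set"
  where "AP_c0 c I = cfun.span {f. c_almost_periodic c I f}"

definition closed_AP_c0 :: "complex \<Rightarrow> real set \<Rightarrow> (real \<Rightarrow> 'e :: complex_banach) set"
  where "closed_AP_c0 c I = AP_topology I closure_of AP_c0 c I"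

text \<open>The limit exists for every \<open>f \<in> AP I\<close>; otherwise \<open>Lim\<close> is an unspecified value.\<close>

definition bohr_coeff :: "real \<Rightarrow> (real \<Rightarrow> 'e :: complex_banach) \<Rightarrow> 'e"
  where "bohr_coeff r f =
    Lim at_top (\<lambda>t :: real. (1 / t) *\<^sub>R
      integral {0..t} (\<lambda>s. exp (- (\<i> * complex_of_real r * complex_of_real s)) *\<^sub>C f s))"

definition bohr_spectrum :: "(real \<Rightarrow> 'e :: complex_banach) \<Rightarrow> real set"
  where "bohr_spectrum f = {r. bohr_coeff r f \<noteq> 0}"

definition AP_spec :: "real set \<Rightarrow> real set \<Rightarrow> (real \<Rightarrow> 'e :: complex_banach) set"
  where "AP_spec \<Lambda> I = {f \<in> AP I. bohr_spectrum f \<subseteq> \<Lambda>}"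

text \<open>
  For \<open>c = 1\<close> constant functions are c-almost periodic and have the frequency \<open>0\<close>, so the equality
  of the closed span with \<open>AP_spec (UNIV - {0}) I\<close> fails although \<open>Arg 1 = 0\<close>.
\<close>

lemma closed_AP_c0_one_neq:
  fixes v :: "'e :: complex_banach"
  assumes I: "I = UNIV \<or> I = {0..}" and v: "v \<noteq> 0"
  shows "(closed_AP_c0 1 I :: (real \<Rightarrow> 'e) set) \<noteq> AP_spec (UNIV - {0}) I"
proof
  define f where "f = (\<lambda>t. if t \<in> I then v else 0)"
  assume eq: "(closed_AP_c0 1 I :: (real \<Rightarrow> 'e) set) = AP_spec (UNIV - {0}) I"
  have "continuous_on I f"
    by (rule continuous_on_eq[OF continuous_on_const[of I v]]) (simp add: f_def)
  moreover have "\<exists>l>0. \<forall>a\<ge>0. {a..a + l} \<inter>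
      {\<tau>. \<tau> > 0 \<and> (\<forall>t\<in>I. norm (f (t + \<tau>) - 1 *\<^sub>C f t) \<le> \<epsilon>)} \<noteq> {}" if "\<epsilon> > 0" for \<epsilon>
  proof (intro exI[of _ 1] conjI allI impI)
    fix a :: real assume "a \<ge> 0"
    then have "a + 1 \<in> {a..a + 1} \<inter>
        {\<tau>. \<tau> > 0 \<and> (\<forall>t\<in>I. norm (f (t + \<tau>) - 1 *\<^sub>C f t) \<le> \<epsilon>)}"
      using I that by (auto simp: f_def scaleC_one)
    then show "{a..a + 1} \<inter>
        {\<tau>. \<tau> > 0 \<and> (\<forall>t\<in>I. norm (f (t + \<tau>) - 1 *\<^sub>C f t) \<le> \<epsilon>)} \<noteq> {}" by blast
  qed simp
  ultimately have f: "c_almost_periodic 1 I f"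
    by (auto simp: c_almost_periodic_def relatively_dense_def f_def)
  interpret Metric_space "AP I :: (real \<Rightarrow> 'e) set" "AP_dist I"
    by (rule Metric_space_AP[OF I])
  have "f \<in> AP_c0 1 I"
    unfolding AP_c0_def using f by (intro cfun.span_base) simp
  then have "f \<in> closed_AP_c0 1 I"
    using f subsetD[OF closure_of_subset_Int[of mtopology "AP_c0 1 I"], of f]
    unfolding closed_AP_c0_def topspace_mtopology by (auto simp: AP_def)
  then have "bohr_coeff 0 f = 0"
    unfolding eq by (auto simp: AP_spec_def bohr_spectrum_def)
  moreover have "bohr_coeff 0 f = v"
    unfolding bohr_coeff_def
  proof (intro tendsto_Lim tendsto_eventually)
    show "\<forall>\<^sub>F t in at_top. (1 / t) *\<^sub>R integral {0..t}
        (\<lambda>s. exp (- (\<i> * complex_of_real 0 * complex_of_real s)) *\<^sub>C f s) = v"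
      using eventually_gt_at_top[of 0]
    proof eventually_elim
      case (elim t)
      have "integral {0..t} (\<lambda>s. exp (- (\<i> * complex_of_real 0 * complex_of_real s)) *\<^sub>C f s)
          = integral {0..t} (\<lambda>_. v)"
        using I by (intro integral_cong) (auto simp: f_def scaleC_one)
      then show ?case using elim by simp
    qed
  qed simp
  ultimately show False using v by simp
qed

end

theory Submission
  imports Defs
begin

text \<open>
  For unimodular \<open>c \<noteq> 1\<close> the closed span consists of the almost periodic functions with mean value
  zero, which are those whose Bohr-Fourier coefficient at the frequency zero vanishes
  (\<open>AP_spec_nonzero_iff\<close>).

  One inclusion is short. If \<open>\<tau>\<close> is a translation number of a \<open>c\<close>-almost periodic function, then
  shifting by \<open>\<tau>\<close> multiplies its long-term averages by \<open>c\<close> up to a small error, but also leaves them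
  almost unchanged. For \<open>c \<noteq> 1\<close> the averages therefore tend to zero (\<open>c_ap_average_tendsto_0\<close>), a
  property that passes to linear combinations and uniform limits.

  For the other inclusion, every exponential \<open>cis (r * t) *\<^sub>C v\<close> with \<open>r \<noteq> 0\<close> is \<open>c\<close>-almost periodic, so
  it suffices to approximate an almost periodic \<open>f\<close> with mean value zero uniformly by trigonometric
  polynomials without constant term (\<open>AP_approximation\<close>). The decisive step is that the
  translation numbers of \<open>f\<close> contain a Bohr set, that is, a set
  \<open>{\<tau>. \<forall>r\<in>R. \<bar>cis (r * \<tau>) - 1\<bar> < \<delta>}\<close> with finitely many frequencies (\<open>AP_imp_bohr_uniform\<close>). It
  follows from Bogolyubov's theorem on sums and differences of sets of positive density, applied
  to the translation numbers rounded to a grid; that theorem comes from Fourier analysis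
  on finite cyclic groups and a compactness argument for the frequencies. A nonnegative trigonometric
  polynomial concentrated on such a Bohr set is an approximate identity for \<open>f\<close>. Convolution with it,
  defined as a limit of averages, yields a trigonometric polynomial whose coefficient at
  frequency zero is a multiple of the mean value of \<open>f\<close>, hence zero. Functions are only shifted
  forwards, so the line and the half-line are treated at once.
\<close>

section \<open>Complex scalar multiplication\<close>

lemma bounded_bilinear_scaleC:
  "bounded_bilinear (scaleC :: complex \<Rightarrow> 'e :: complex_banach \<Rightarrow> 'e)"
proof
  fix r :: real and a b :: complex and x y :: 'e
  show "(a + b) *\<^sub>C x = a *\<^sub>C x + b *\<^sub>C x" by (rule scaleC_add_left)
  show "a *\<^sub>C (x + y) = a *\<^sub>C x + a *\<^sub>C y" by (rule scaleC_add_right)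
  show "(r *\<^sub>R a) *\<^sub>C x = r *\<^sub>R (a *\<^sub>C x)"
    by (simp only: scaleR_conv_of_real scaleC_of_real flip: scaleC_scaleC)
  show "a *\<^sub>C (r *\<^sub>R x) = r *\<^sub>R (a *\<^sub>C x)"
    by (simp only: scaleC_scaleC mult.commute flip: scaleC_of_real)
  show "\<exists>K. \<forall>(a :: complex) x :: 'e. norm (a *\<^sub>C x) \<le> norm a * norm x * K"
    by (intro exI[of _ 1]) (simp add: norm_scaleC)
qed

interpretation scaleC: bounded_bilinear "scaleC :: complex \<Rightarrow> 'e :: complex_banach \<Rightarrow> 'e"
  by (rule bounded_bilinear_scaleC)

section \<open>Shifts of c-almost periodic functions\<close>

lemma half_line_subset:
  assumes "I = UNIV \<or> I = {0..}"
  shows "{0 :: real..} \<subseteq> I"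
  using assms by auto

lemma half_line_add_closed:
  assumes "I = UNIV \<or> I = {0..}" "t \<in> I" "0 \<le> u"
  shows "t + u \<in> (I :: real set)"
  using assms by auto

lemma c_ap_continuous:
  assumes "c_almost_periodic c I f"
  shows "continuous_on I f"
  using assms by (simp add: c_almost_periodic_def)

lemma c_ap_continuous_Ici:
  assumes I: "I = UNIV \<or> I = {0..}" and f: "c_almost_periodic c I f"
  shows "continuous_on {0..} f"
  using c_ap_continuous[OF f] half_line_subset[OF I] by (rule continuous_on_subset)

text \<open>
  A shift by a suitable \<open>\<epsilon>\<close>-translation number carries any \<open>t \<in> I\<close> into one fixed compact interval,
  at the price of a unimodular factor \<open>z\<close>, which is \<open>1\<close>, \<open>c\<close> or \<open>c\<inverse>\<close>. Stating this for the
  whole forward orbit \<open>t + u\<close> makes compactness arguments and estimates of averages available in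
  the same form for both choices of \<open>I\<close>.
\<close>

lemma c_ap_shift_to_compact:
  fixes f :: "real \<Rightarrow> 'e :: complex_banach"
  assumes I: "I = UNIV \<or> I = {0..}" and c: "cmod c = 1"
    and f: "c_almost_periodic c I f" and \<epsilon>: "\<epsilon> > 0"
  obtains l where "l > 0"
    "\<And>t. t \<in> I \<Longrightarrow> \<exists>s\<in>{0..l}. \<exists>z. cmod z = 1 \<and> (c = 1 \<longrightarrow> z = 1) \<and>
        (\<forall>u\<ge>0. norm (f (t + u) - z *\<^sub>C f (s + u)) \<le> \<epsilon>)"
proof -
  define S where "S = {\<tau>. \<tau> > 0 \<and> (\<forall>t\<in>I. norm (f (t + \<tau>) - c *\<^sub>C f t) \<le> \<epsilon>)}"
  have "relatively_dense S"
    using f \<epsilon> unfolding c_almost_periodic_def S_def by blast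
  then obtain l where l: "l > 0" and ne: "\<And>a. a \<ge> 0 \<Longrightarrow> \<exists>\<tau>\<in>S. a \<le> \<tau> \<and> \<tau> \<le> a + l"
    unfolding relatively_dense_def by (metis Int_emptyI atLeastAtMost_iff)
  have c0: "c \<noteq> 0" using c by auto
  show thesis
  proof (rule that[OF l])
    fix t assume t: "t \<in> I"
    consider "t \<ge> l" | "0 \<le> t" "t \<le> l" | "t < 0" by linarith
    then show "\<exists>s\<in>{0..l}. \<exists>z. cmod z = 1 \<and> (c = 1 \<longrightarrow> z = 1) \<and>
        (\<forall>u\<ge>0. norm (f (t + u) - z *\<^sub>C f (s + u)) \<le> \<epsilon>)"
    proof cases
      case 1
      then obtain \<tau> where \<tau>: "\<tau> \<in> S" "t - l \<le> \<tau>" "\<tau> \<le> t" using ne[of "t - l"] by auto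
      have "norm (f (t + u) - c *\<^sub>C f (t - \<tau> + u)) \<le> \<epsilon>" if "u \<ge> 0" for u
      proof -
        have "t - \<tau> + u \<in> I" using half_line_subset[OF I] \<tau> that by auto
        then have "norm (f (t - \<tau> + u + \<tau>) - c *\<^sub>C f (t - \<tau> + u)) \<le> \<epsilon>"
          using \<tau>(1) unfolding S_def by blast
        then show ?thesis by (simp add: algebra_simps)
      qed
      then show ?thesis
        using \<tau> c by (intro bexI[of _ "t - \<tau>"] exI[of _ c]) auto
    next
      case 2
      then show ?thesis
        using \<epsilon> by (intro bexI[of _ t] exI[of _ 1]) (auto simp: scaleC_one)
    next
      case 3
      then obtain \<tau> where \<tau>: "\<tau> \<in> S" "- t \<le> \<tau>" "\<tau> \<le> - t + l" using ne[of "- t"] by auto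
      have "norm (f (t + u) - inverse c *\<^sub>C f (t + \<tau> + u)) \<le> \<epsilon>" if "u \<ge> 0" for u
      proof -
        have "norm (f (t + u + \<tau>) - c *\<^sub>C f (t + u)) \<le> \<epsilon>"
          using \<tau>(1) half_line_add_closed[OF I t that] unfolding S_def by blast
        moreover have "f (t + u) - inverse c *\<^sub>C f (t + \<tau> + u)
            = (- inverse c) *\<^sub>C (f (t + u + \<tau>) - c *\<^sub>C f (t + u))"
          using c0 by (simp add: scaleC.diff_right scaleC.minus_left scaleC_scaleC scaleC_one
              algebra_simps)
        ultimately show ?thesis using c by (simp add: norm_scaleC norm_inverse)
      qed
      then show ?thesis
        using \<tau> c by (intro bexI[of _ "t + \<tau>"] exI[of _ "inverse c"]) (auto simp: norm_inverse)
    qed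
  qed
qed

lemma c_ap_bounded:
  fixes f :: "real \<Rightarrow> 'e :: complex_banach"
  assumes I: "I = UNIV \<or> I = {0..}" and c: "cmod c = 1" and f: "c_almost_periodic c I f"
  obtains B where "B > 0" "\<And>t. t \<in> I \<Longrightarrow> norm (f t) \<le> B"
proof -
  obtain l where l: "l > 0" "\<And>t. t \<in> I \<Longrightarrow> \<exists>s\<in>{0..l}. \<exists>z. cmod z = 1 \<and> (c = 1 \<longrightarrow> z = 1) \<and>
        (\<forall>u\<ge>0. norm (f (t + u) - z *\<^sub>C f (s + u)) \<le> 1)"
    using c_ap_shift_to_compact[OF I c f zero_less_one] by blast
  have "continuous_on {0..l} f"
    by (rule continuous_on_subset[OF c_ap_continuous_Ici[OF I f]]) auto
  then have "bounded (f ` {0..l})"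
    by (intro compact_imp_bounded compact_continuous_image) auto
  then obtain B where B: "B > 0" "\<And>s. s \<in> {0..l} \<Longrightarrow> norm (f s) \<le> B"
    unfolding bounded_pos by blast
  show thesis
  proof (rule that[of "B + 1"])
    fix t assume "t \<in> I"
    then obtain s z where s: "s \<in> {0..l}" "cmod z = 1"
        "\<forall>u\<ge>0. norm (f (t + u) - z *\<^sub>C f (s + u)) \<le> 1"
      using l(2) by blast
    then have "norm (f t - z *\<^sub>C f s) \<le> 1" using spec[OF s(3), of 0] by simp
    moreover have "norm (z *\<^sub>C f s) \<le> B" using s B by (simp add: norm_scaleC)
    ultimately show "norm (f t) \<le> B + 1"
      using norm_triangle_sub[of "f t" "z *\<^sub>C f s"] by linarith
  qed (use B in simp)
qed

text \<open>
  Uniform continuity on the compact interval \<open>{0..l + 1}\<close> transfers to \<open>I\<close>. The extra unit of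
  length leaves room for the second point, which lies at most \<open>h \<le> 1\<close> to the right.
\<close>

lemma AP_uniformly_continuous:
  fixes f :: "real \<Rightarrow> 'e :: complex_banach"
  assumes I: "I = UNIV \<or> I = {0..}" and f: "f \<in> AP I" and \<epsilon>: "\<epsilon> > 0"
  obtains h where "h > 0"
    "\<And>s t. s \<in> I \<Longrightarrow> t \<in> I \<Longrightarrow> \<bar>s - t\<bar> \<le> h \<Longrightarrow> norm (f s - f t) \<le> \<epsilon>"
proof -
  have f': "c_almost_periodic 1 I f" using f by (simp add: AP_def)
  have \<epsilon>3: "\<epsilon> / 3 > 0" using \<epsilon> by simp
  obtain l where l: "l > 0" "\<And>t. t \<in> I \<Longrightarrow> \<exists>s\<in>{0..l}. \<exists>z. cmod z = 1 \<and> (1 = (1::complex) \<longrightarrow> z = 1) \<and>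
        (\<forall>u\<ge>0. norm (f (t + u) - z *\<^sub>C f (s + u)) \<le> \<epsilon> / 3)"
    using c_ap_shift_to_compact[OF I norm_one f' \<epsilon>3] by blast
  have "continuous_on {0..l + 1} f"
    by (rule continuous_on_subset[OF c_ap_continuous_Ici[OF I f']]) auto
  then have "uniformly_continuous_on {0..l + 1} f"
    by (intro compact_uniformly_continuous) auto
  then obtain d where d: "d > 0"
    "\<And>s t. s \<in> {0..l+1} \<Longrightarrow> t \<in> {0..l+1} \<Longrightarrow> dist t s < d \<Longrightarrow> dist (f t) (f s) < \<epsilon> / 3"
    unfolding uniformly_continuous_on_def using \<epsilon> by (metis zero_less_divide_iff zero_less_numeral)
  define h where "h = min 1 (d / 2)"
  have key: "norm (f (t + u) - f t) \<le> \<epsilon>" if t: "t \<in> I" and u: "0 \<le> u" "u \<le> h" for t u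
  proof -
    obtain s z where s: "s \<in> {0..l}" "z = 1"
        "\<forall>u\<ge>0. norm (f (t + u) - z *\<^sub>C f (s + u)) \<le> \<epsilon> / 3"
      using l(2)[OF t] by blast
    have "norm (f (t + u) - f (s + u)) \<le> \<epsilon> / 3" "norm (f t - f s) \<le> \<epsilon> / 3"
      using s(3) u s(2) spec[OF s(3), of 0] by (auto simp: scaleC_one)
    moreover have "norm (f (s + u) - f s) < \<epsilon> / 3"
      using d(2)[of s "s + u"] s(1) u d(1) unfolding h_def by (auto simp: dist_norm)
    ultimately show ?thesis by norm
  qed
  show thesis
  proof (rule that[of h])
    show "h > 0" using d by (simp add: h_def)
    fix s t assume st: "s \<in> I" "t \<in> I" "\<bar>s - t\<bar> \<le> h"
    then show "norm (f s - f t) \<le> \<epsilon>"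
      using key[of s "t - s"] key[of t "s - t"]
      by (cases "s \<le> t") (auto simp: norm_minus_commute)
  qed
qed

section \<open>Averages\<close>

definition average :: "(real \<Rightarrow> 'a :: real_normed_vector) \<Rightarrow> real \<Rightarrow> 'a"
  where "average f T = (1 / T) *\<^sub>R integral {0..T} f"

lemma average_add:
  assumes "continuous_on {0..} f" "continuous_on {0..} (g :: real \<Rightarrow> 'a :: banach)"
  shows "average (\<lambda>t. f t + g t) T = average f T + average g T"
proof -
  have "f integrable_on {0..T}" "g integrable_on {0..T}"
    by (intro integrable_continuous_interval continuous_on_subset[OF assms(1)]
        continuous_on_subset[OF assms(2)]; auto)+
  then show ?thesis by (simp add: average_def integral_add scaleR_add_right)
qed

lemma average_scaleC:
  fixes f :: "real \<Rightarrow> 'e :: complex_banach"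
  assumes "continuous_on {0..} f"
  shows "average (\<lambda>t. a *\<^sub>C f t) T = a *\<^sub>C average f T"
proof -
  have "f integrable_on {0..T}"
    by (intro integrable_continuous_interval continuous_on_subset[OF assms(1)]) auto
  then have "integral {0..T} (\<lambda>t. a *\<^sub>C f t) = a *\<^sub>C integral {0..T} f"
    using integral_linear[OF _ scaleC.bounded_linear_right, of f "{0..T}" a] by (simp add: o_def)
  then show ?thesis by (simp add: average_def scaleC.scaleR_right)
qed

lemma average_diff_bound:
  fixes f g :: "real \<Rightarrow> 'a :: banach"
  assumes T: "T > 0" and f: "continuous_on {0..T} f" and g: "continuous_on {0..T} g"
    and le: "\<And>t. t \<in> {0..T} \<Longrightarrow> norm (f t - g t) \<le> \<epsilon>"
  shows "norm (average f T - average g T) \<le> \<epsilon>"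
proof -
  have int: "f integrable_on {0..T}" "g integrable_on {0..T}"
    using f g by (auto intro: integrable_continuous_interval)
  have "norm (integral {0..T} (\<lambda>t. f t - g t)) \<le> \<epsilon> * (T - 0)"
    by (rule integral_bound) (use T le f g in \<open>auto intro!: continuous_intros\<close>)
  then have "norm (integral {0..T} f - integral {0..T} g) \<le> \<epsilon> * T"
    using int by (simp add: integral_diff)
  moreover have "average f T - average g T = (1 / T) *\<^sub>R (integral {0..T} f - integral {0..T} g)"
    by (simp add: average_def scaleR_diff_right)
  ultimately show ?thesis using T by (simp add: divide_le_eq)
qed

text \<open>
  The averages over \<open>{0..T}\<close> and \<open>{s..T + s}\<close> differ only by two integrals over intervals of length \<open>s\<close>.
\<close>

lemma average_shift_bound:
  fixes f :: "real \<Rightarrow> 'a :: banach"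
  assumes f: "continuous_on {0..} f" and B: "\<And>t. t \<ge> 0 \<Longrightarrow> norm (f t) \<le> B"
    and s: "s \<ge> 0" and T: "T > 0"
  shows "norm (average (\<lambda>t. f (s + t)) T - average f T) \<le> 2 * s * B / T"
proof -
  have int: "f integrable_on {a..b}" if "a \<ge> 0" for a b
    by (intro integrable_continuous_interval continuous_on_subset[OF f]) (use that in auto)
  have bd: "norm (integral {a..a + s} f) \<le> B * s" if "a \<ge> 0" for a
  proof -
    have "norm (integral {a..a + s} f) \<le> B * (a + s - a)"
      by (rule integral_bound) (use that s B in \<open>auto intro!: continuous_on_subset[OF f]\<close>)
    then show ?thesis by simp
  qed
  have shift: "integral {0..T} (\<lambda>t. f (s + t)) = integral {s..T + s} f"
    using integral_shift_Icc_real[of 0 T f s] by (simp add: o_def)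
  have "integral {0..s} f + integral {s..T + s} f = integral {0..T + s} f"
    "integral {0..T} f + integral {T..T + s} f = integral {0..T + s} f"
    using s T int[of 0] by (auto intro!: Henstock_Kurzweil_Integration.integral_combine)
  then have eq: "integral {s..T + s} f - integral {0..T} f = integral {T..T+s} f - integral {0..0 + s} f"
    by (simp add: algebra_simps)
  have "norm (integral {s..T + s} f - integral {0..T} f) \<le> 2 * s * B"
    unfolding eq using bd[of T] bd[of 0] T
    by (intro order_trans[OF norm_triangle_ineq4]) (simp add: algebra_simps)
  moreover have "average (\<lambda>t. f (s + t)) T - average f T
      = (1 / T) *\<^sub>R (integral {s..T + s} f - integral {0..T} f)"
    by (simp add: average_def shift scaleR_diff_right)
  ultimately show ?thesis using T by (simp add: divide_right_mono)
qed

text \<open>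
  If \<open>\<tau>\<close> is a translation number of \<open>f\<close>, then the average of \<open>f\<close> is nearly unchanged by the shift
  by \<open>\<tau>\<close>, but the shift also multiplies it by \<open>c\<close> up to a small error. For \<open>c \<noteq> 1\<close> this leaves only
  the limit zero.
\<close>

lemma c_ap_average_tendsto_0:
  fixes f :: "real \<Rightarrow> 'e :: complex_banach"
  assumes I: "I = UNIV \<or> I = {0..}" and c: "cmod c = 1" "c \<noteq> 1" and f: "c_almost_periodic c I f"
  shows "(average f \<longlongrightarrow> 0) at_top"
proof -
  obtain B where B: "B > 0" "\<And>t. t \<in> I \<Longrightarrow> norm (f t) \<le> B"
    using c_ap_bounded[OF I c(1) f] by blast
  have cont: "continuous_on {0..} f"
    by (rule c_ap_continuous_Ici[OF I f])
  have c1: "cmod (1 - c) > 0" using c by auto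
  show ?thesis
    unfolding tendsto_iff dist_norm diff_0_right
  proof (intro allI impI)
    fix \<epsilon> :: real assume \<epsilon>: "\<epsilon> > 0"
    define \<eta> where "\<eta> = \<epsilon> * cmod (1 - c) / 2"
    have \<eta>: "\<eta> > 0" using \<epsilon> c1 by (simp add: \<eta>_def)
    then have "relatively_dense {\<tau>. \<tau> > 0 \<and> (\<forall>t\<in>I. norm (f (t + \<tau>) - c *\<^sub>C f t) \<le> \<eta>)}"
      using f unfolding c_almost_periodic_def by blast
    then obtain \<tau> where \<tau>: "\<tau> > 0" "\<And>t. t \<in> I \<Longrightarrow> norm (f (t + \<tau>) - c *\<^sub>C f t) \<le> \<eta>"
      unfolding relatively_dense_def by blast
    have "\<forall>\<^sub>F T in at_top. T > 2 * \<tau> * B / \<eta>" "\<forall>\<^sub>F T :: real in at_top. T > 0"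
      by (rule eventually_gt_at_top)+
    then show "\<forall>\<^sub>F T in at_top. norm (average f T) < \<epsilon>"
    proof eventually_elim
      case (elim T)
      have sub: "continuous_on {0..T} f" "continuous_on {0..T} (\<lambda>t. f (\<tau> + t))"
        using cont \<tau> by (auto intro!: continuous_on_compose2[OF cont] continuous_intros
            elim: continuous_on_subset)
      have "norm (average (\<lambda>t. f (\<tau> + t)) T - average f T) \<le> 2 * \<tau> * B / T"
        by (rule average_shift_bound)
          (use cont B \<tau> elim half_line_subset[OF I] in auto)
      moreover have "norm (average (\<lambda>t. f (\<tau> + t)) T - average (\<lambda>t. c *\<^sub>C f t) T) \<le> \<eta>"
        by (rule average_diff_bound)
          (use elim sub \<tau>(2) half_line_subset[OF I] in
            \<open>auto simp: add.commute intro!: scaleC.continuous_on continuous_intros\<close>)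
      moreover have "average (\<lambda>t. c *\<^sub>C f t) T = c *\<^sub>C average f T"
        by (rule average_scaleC[OF cont])
      ultimately have "norm (average f T - c *\<^sub>C average f T) \<le> 2 * \<tau> * B / T + \<eta>"
        by (smt (verit) norm_minus_commute norm_diff_triangle_le)
      also have "\<dots> < 2 * \<eta>"
        using elim \<eta> by (simp add: field_simps)
      also have "average f T - c *\<^sub>C average f T = (1 - c) *\<^sub>C average f T"
        by (simp add: scaleC.diff_left scaleC_one)
      finally show ?case using c1 by (simp add: norm_scaleC \<eta>_def mult.commute)
    qed
  qed
qed

section \<open>Bogolyubov's theorem\<close>

text \<open>
  The sets \<open>bohr_set R \<delta>\<close> with \<open>R\<close> finite and \<open>\<delta> > 0\<close> are the traces on \<open>\<real>\<close> of the basic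
  neighbourhoods of zero in the Bohr compactification.
\<close>

definition bohr_set :: "real set \<Rightarrow> real \<Rightarrow> real set"
  where "bohr_set R \<delta> = {t. \<forall>r\<in>R. cmod (cis (r * t) - 1) < \<delta>}"

lemma cis_eq_1_imp:
  assumes "cis x = 1"
  shows "\<exists>n :: int. x = 2 * pi * of_int n"
proof -
  have "cos x = 1" using assms by (metis cis.sel(1) one_complex.sel(1))
  then show ?thesis using cos_one_2pi_int[of x] by (auto simp: mult.commute mult.left_commute)
qed

lemma sum_cis_roots_of_unity:
  fixes y :: int
  assumes M: "M > 0"
  shows "(\<Sum>\<xi><M. cis (2 * pi * real \<xi> / real M * of_int y)) =
    (if int M dvd y then of_nat M else 0)"
proof -
  define z where "z = cis (2 * pi * of_int y / real M)"
  have pow: "cis (2 * pi * real \<xi> / real M * of_int y) = z ^ \<xi>" for \<xi>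
    by (simp add: z_def Complex.DeMoivre mult_ac)
  have zM: "z ^ M = 1"
    using M by (simp add: z_def Complex.DeMoivre cis_multiple_2pi)
  have "z = 1 \<longleftrightarrow> int M dvd y"
  proof
    assume "z = 1"
    then obtain n :: int where "2 * pi * of_int y / real M = 2 * pi * of_int n"
      using cis_eq_1_imp unfolding z_def by blast
    then have "real_of_int y = real_of_int (n * int M)" using M by (simp add: field_simps)
    then have "y = n * int M" by (simp only: of_int_eq_iff)
    then show "int M dvd y" by simp
  next
    assume "int M dvd y"
    then obtain n where "y = int M * n" by (rule dvdE)
    then have "z = cis (2 * pi * of_int n)" using M by (simp add: z_def mult.assoc del: cis_multiple_2pi)
    also have "\<dots> = 1" by (rule cis_multiple_2pi) simp
    finally show "z = 1" .
  qed
  then show ?thesis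
    unfolding pow using zM by (auto simp: geometric_sum)
qed

text \<open>
  The set \<open>A\<close> is regarded as a subset of the cyclic group of order \<open>M = 4 N\<close>. With \<open>F\<close> the discrete
  Fourier transform of its indicator function, the sum over \<open>\<xi>\<close> of \<open>\<bar>F \<xi>\<bar>\<^sup>4 cis (\<omega> \<xi> * x)\<close> is \<open>M\<close>
  times the number of solutions of \<open>x + a + b = c + d\<close> modulo \<open>M\<close>. The term \<open>\<xi> = 0\<close> contributes
  \<open>n^4\<close>. The other frequencies in the large spectrum \<open>\<Lambda>\<close> contribute a nonnegative real part when
  \<open>x\<close> lies in the Bohr set, and by Parseval's identity the remaining ones cannot cancel more than
  half of \<open>n^4\<close>. Parseval's identity also bounds the size of \<open>\<Lambda>\<close> in terms of the density alone,
  which is what permits a passage to the limit in \<open>N\<close>.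
\<close>

lemma bogolyubov_cyclic:
  fixes A :: "nat set" and L :: real
  assumes A: "A \<subseteq> {..<N}" "A \<noteq> {}" and L: "real N \<le> L * card A" "L \<ge> 1"
  shows "\<exists>\<Theta>. finite \<Theta> \<and> \<Theta> \<subseteq> {0..2 * pi} \<and> card \<Theta> \<le> 32 * L\<^sup>2 \<and>
    (\<forall>x<2 * N. real x \<in> bohr_set \<Theta> 1 \<longrightarrow> (\<exists>a\<in>A. \<exists>b\<in>A. \<exists>c\<in>A. \<exists>d\<in>A. x + a + b = c + d))"
proof -
  define M where "M = 4 * N"
  define \<omega> where "\<omega> \<xi> = 2 * pi * real \<xi> / real M" for \<xi>
  define F where "F \<xi> = (\<Sum>a\<in>A. cis (\<omega> \<xi> * real a))" for \<xi>
  define n where "n = real (card A)"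
  define \<Lambda> where "\<Lambda> = {\<xi>\<in>{..<M}. (cmod (F \<xi>))\<^sup>2 \<ge> n\<^sup>2 / (8 * L)}"
  have finA: "finite A" using A finite_subset by blast
  have n: "n > 0" using A finA by (simp add: n_def card_gt_0_iff)
  have N: "N > 0" using A by auto
  then have M: "M > 0" by (simp add: M_def)
  have \<omega>_sum: "(\<Sum>\<xi><M. cis (\<omega> \<xi> * of_int y)) = (if int M dvd y then of_nat M else 0)" for y
    unfolding \<omega>_def by (rule sum_cis_roots_of_unity[OF M])
  have cnjF: "cnj (F \<xi>) = (\<Sum>a\<in>A. cis (\<omega> \<xi> * - real a))" for \<xi>
    by (simp add: F_def cis_cnj)

  have "(\<Sum>\<xi><M. of_real ((cmod (F \<xi>))\<^sup>2)) = (\<Sum>\<xi><M. F \<xi> * cnj (F \<xi>))"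
    by (simp only: complex_norm_square)
  also have "\<dots> = (\<Sum>\<xi><M. \<Sum>a\<in>A. \<Sum>b\<in>A. cis (\<omega> \<xi> * of_int (int a - int b)))"
    unfolding cnjF unfolding F_def sum_product
    by (simp add: cis_mult algebra_simps)
  also have "\<dots> = (\<Sum>a\<in>A. \<Sum>b\<in>A. \<Sum>\<xi><M. cis (\<omega> \<xi> * of_int (int a - int b)))"
    by (subst sum.swap, rule sum.cong[OF refl], rule sum.swap)
  also have "\<dots> = (\<Sum>a\<in>A. \<Sum>b\<in>A. if a = b then of_nat M else 0)"
  proof (intro sum.cong refl)
    fix a b assume "a \<in> A" "b \<in> A"
    then have "a < M" "b < M" using A by (auto simp: M_def)
    then have "int M dvd int a - int b \<longleftrightarrow> a = b"
      by (simp flip: mod_eq_dvd_iff of_nat_mod)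
    then show "(\<Sum>\<xi><M. cis (\<omega> \<xi> * of_int (int a - int b))) = (if a = b then of_nat M else 0)"
      by (simp only: \<omega>_sum)
  qed
  also have "\<dots> = of_real (real M * n)"
    using finA by (simp add: n_def mult.commute)
  finally have "of_real (\<Sum>\<xi><M. (cmod (F \<xi>))\<^sup>2) = (of_real (real M * n) :: complex)"
    by simp
  then have parseval: "(\<Sum>\<xi><M. (cmod (F \<xi>))\<^sup>2) = real M * n"
    by (simp only: of_real_eq_iff)

  have card: "card \<Lambda> \<le> 32 * L\<^sup>2"
  proof -
    have "card \<Lambda> * (n\<^sup>2 / (8 * L)) = (\<Sum>\<xi>\<in>\<Lambda>. n\<^sup>2 / (8 * L))" by simp
    also have "\<dots> \<le> (\<Sum>\<xi>\<in>\<Lambda>. (cmod (F \<xi>))\<^sup>2)"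
      by (rule sum_mono) (simp add: \<Lambda>_def)
    also have "\<dots> \<le> (\<Sum>\<xi><M. (cmod (F \<xi>))\<^sup>2)"
      by (rule sum_mono2) (auto simp: \<Lambda>_def)
    also have "\<dots> \<le> 4 * L * n\<^sup>2"
      using mult_right_mono[OF L(1), of "4 * n"] n
      unfolding parseval by (simp add: M_def n_def power2_eq_square mult_ac)
    finally have "card \<Lambda> * n\<^sup>2 \<le> 32 * L\<^sup>2 * n\<^sup>2"
      using L(2) by (simp add: field_simps power2_eq_square)
    then show ?thesis using n by simp
  qed

  have main: "\<exists>a\<in>A. \<exists>b\<in>A. \<exists>c\<in>A. \<exists>d\<in>A. x + a + b = c + d"
    if x: "x < 2 * N" "\<And>\<xi>. \<xi> \<in> \<Lambda> \<Longrightarrow> cmod (cis (\<omega> \<xi> * real x) - 1) < 1" for x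
  proof (rule ccontr)
    assume no: "\<not> ?thesis"
    define \<sigma> where "\<sigma> = (\<lambda>(a, b). a + b :: nat)"
    have FF: "F \<xi> * F \<xi> = (\<Sum>p\<in>A \<times> A. cis (\<omega> \<xi> * real (\<sigma> p)))" for \<xi>
      unfolding F_def sum_product sum.cartesian_product
      by (intro sum.cong) (auto simp: \<sigma>_def cis_mult algebra_simps)
    have cFF: "cnj (F \<xi>) * cnj (F \<xi>) = (\<Sum>p\<in>A \<times> A. cis (\<omega> \<xi> * - real (\<sigma> p)))" for \<xi>
      unfolding cnjF sum_product sum.cartesian_product
      by (intro sum.cong) (auto simp: \<sigma>_def cis_mult algebra_simps)
    have "(\<Sum>\<xi><M. of_real ((cmod (F \<xi>))^4) * cis (\<omega> \<xi> * real x))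
        = (\<Sum>\<xi><M. (F \<xi> * F \<xi>) * (cnj (F \<xi>) * cnj (F \<xi>)) * cis (\<omega> \<xi> * real x))"
    proof (intro sum.cong refl)
      fix \<xi>
      have "of_real ((cmod (F \<xi>))^4) = (F \<xi> * cnj (F \<xi>)) * (F \<xi> * cnj (F \<xi>))"
        unfolding complex_norm_square[symmetric] by (simp flip: power_add power2_eq_square)
      then show "of_real ((cmod (F \<xi>))^4) * cis (\<omega> \<xi> * real x) =
          (F \<xi> * F \<xi>) * (cnj (F \<xi>) * cnj (F \<xi>)) * cis (\<omega> \<xi> * real x)"
        by (simp add: mult_ac)
    qed
    also have "\<dots> = (\<Sum>\<xi><M. \<Sum>p\<in>A \<times> A. \<Sum>q\<in>A \<times> A.
        cis (\<omega> \<xi> * of_int (int x + int (\<sigma> p) - int (\<sigma> q))))"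
      unfolding FF cFF unfolding sum_product unfolding sum_distrib_right
      by (intro sum.cong refl) (simp add: cis_mult algebra_simps)
    also have "\<dots> = (\<Sum>p\<in>A \<times> A. \<Sum>q\<in>A \<times> A. \<Sum>\<xi><M.
        cis (\<omega> \<xi> * of_int (int x + int (\<sigma> p) - int (\<sigma> q))))"
      by (subst sum.swap, rule sum.cong[OF refl], rule sum.swap)
    also have "\<dots> = 0"
    proof (rule sum.neutral, rule ballI, rule sum.neutral, rule ballI)
      fix p q assume pq: "p \<in> A \<times> A" "q \<in> A \<times> A"
      obtain a b c d where abcd: "p = (a, b)" "q = (c, d)" by (cases p, cases q) blast
      have mem: "a \<in> A" "b \<in> A" "c \<in> A" "d \<in> A" using pq abcd by auto
      then have "a < N" "b < N" "c < N" "d < N" using A by auto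
      then have lt: "x + a + b < M" "c + d < M" using x by (auto simp: M_def)
      have "\<not> int M dvd int x + int (\<sigma> p) - int (\<sigma> q)"
      proof
        assume "int M dvd int x + int (\<sigma> p) - int (\<sigma> q)"
        then have "int (x + a + b) mod int M = int (c + d) mod int M"
          by (simp add: abcd \<sigma>_def mod_eq_dvd_iff add.assoc)
        then have "x + a + b = c + d" using lt by (simp flip: of_nat_mod of_nat_add)
        then show False using no mem by blast
      qed
      then show "(\<Sum>\<xi><M. cis (\<omega> \<xi> * of_int (int x + int (\<sigma> p) - int (\<sigma> q)))) = 0"
        by (simp only: \<omega>_sum if_False)
    qed
    \<comment> \<open>The modulus \<open>4 N\<close> exceeds both sides of \<open>x + a + b = c + d\<close>, so a congruence is an equation
      and the inner sums over all frequencies vanish.\<close>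
    finally have zero: "(\<Sum>\<xi><M. of_real ((cmod (F \<xi>))^4) * cis (\<omega> \<xi> * real x)) = 0" .
    have "Re (\<Sum>\<xi><M. of_real ((cmod (F \<xi>))^4) * cis (\<omega> \<xi> * real x)) = 0"
      by (simp only: zero zero_complex.sel)
    then have zero_Re: "(\<Sum>\<xi><M. (cmod (F \<xi>))^4 * cos (\<omega> \<xi> * real x)) = 0"
      by (simp only: Re_sum times_complex.sel Re_complex_of_real Im_complex_of_real
          cis.sel mult_zero_left diff_zero)

    have bound: "(if \<xi> = 0 then n^4 else 0) - n\<^sup>2 / (8 * L) * (cmod (F \<xi>))\<^sup>2
        \<le> (cmod (F \<xi>))^4 * cos (\<omega> \<xi> * real x)" if \<xi>: "\<xi> < M" for \<xi>
    proof (cases "\<xi> \<in> \<Lambda>")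
      case True
      have "1 - cos (\<omega> \<xi> * real x) < 1"
        using x(2)[OF True] abs_Re_le_cmod[of "cis (\<omega> \<xi> * real x) - 1"] by simp
      then have pos: "cos (\<omega> \<xi> * real x) > 0" by simp
      have nn: "n\<^sup>2 / (8 * L) * (cmod (F \<xi>))\<^sup>2 \<ge> 0" using L by simp
      show ?thesis
      proof (cases "\<xi> = 0")
        case True
        then show ?thesis using nn by (simp add: F_def \<omega>_def n_def)
      next
        case False
        have "(cmod (F \<xi>))^4 * cos (\<omega> \<xi> * real x) \<ge> 0" using pos by simp
        then show ?thesis using False nn by simp
      qed
    next
      case False
      then have small: "(cmod (F \<xi>))\<^sup>2 \<le> n\<^sup>2 / (8 * L)" using \<xi> by (simp add: \<Lambda>_def)
      have "\<xi> \<noteq> 0"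
      proof
        assume "\<xi> = 0"
        then have "n\<^sup>2 < n\<^sup>2 / (8 * L)"
          using False \<xi> by (simp add: \<Lambda>_def F_def \<omega>_def n_def)
        then show False using n L(2) by (simp add: field_simps)
      qed
      have "- ((cmod (F \<xi>))^4 * cos (\<omega> \<xi> * real x)) \<le> (cmod (F \<xi>))^4 * 1"
        unfolding mult_minus_right[symmetric]
        using cos_ge_minus_one[of "\<omega> \<xi> * real x"] by (intro mult_left_mono) auto
      also have "\<dots> = (cmod (F \<xi>))\<^sup>2 * (cmod (F \<xi>))\<^sup>2" by (simp flip: power_add)
      also have "\<dots> \<le> n\<^sup>2 / (8 * L) * (cmod (F \<xi>))\<^sup>2"
        using small by (intro mult_right_mono) auto
      finally show ?thesis using \<open>\<xi> \<noteq> 0\<close> by simp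
    qed
    have "n^4 - n\<^sup>2 / (8 * L) * (real M * n)
        = (\<Sum>\<xi><M. (if \<xi> = 0 then n^4 else 0) - n\<^sup>2 / (8 * L) * (cmod (F \<xi>))\<^sup>2)"
      using M unfolding sum_subtractf parseval[symmetric] sum_distrib_left by simp
    also have "\<dots> \<le> (\<Sum>\<xi><M. (cmod (F \<xi>))^4 * cos (\<omega> \<xi> * real x))"
      by (rule sum_mono) (use bound in simp)
    finally have "n^4 \<le> n\<^sup>2 / (8 * L) * (real M * n)" using zero_Re by simp
    also have "\<dots> \<le> n\<^sup>2 / (8 * L) * (4 * L * n * n)"
      using L n by (intro mult_left_mono) (auto simp: M_def n_def mult_right_mono)
    also have "\<dots> = n^4 / 2"
      using L(2) by (simp add: field_simps eval_nat_numeral)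
    finally show False using n by simp
  qed

  show ?thesis
  proof (intro exI[of _ "\<omega> ` \<Lambda>"] conjI allI impI)
    have fin: "finite \<Lambda>" by (simp add: \<Lambda>_def)
    then show "finite (\<omega> ` \<Lambda>)" by simp
    show "real (card (\<omega> ` \<Lambda>)) \<le> 32 * L\<^sup>2"
      using card card_image_le[OF fin, of \<omega>] by linarith
    show "\<omega> ` \<Lambda> \<subseteq> {0..2 * pi}"
      by (auto simp: \<omega>_def \<Lambda>_def divide_le_eq)
    fix x assume "x < 2 * N" "real x \<in> bohr_set (\<omega> ` \<Lambda>) 1"
    then show "\<exists>a\<in>A. \<exists>b\<in>A. \<exists>c\<in>A. \<exists>d\<in>A. x + a + b = c + d"
      by (intro main) (auto simp: bohr_set_def)
  qed
qed

lemma common_convergent_subsequence: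
  fixes \<theta> :: "nat \<Rightarrow> nat \<Rightarrow> real"
  assumes "\<And>n j. \<theta> n j \<in> {a..b}"
  shows "\<exists>\<rho> l. strict_mono (\<rho> :: nat \<Rightarrow> nat) \<and> (\<forall>j<k. (\<lambda>n. \<theta> (\<rho> n) j) \<longlonglongrightarrow> l j)"
proof (induction k)
  case 0
  show ?case by (intro exI[of _ id]) (auto simp: strict_mono_def)
next
  case (Suc k)
  then obtain \<rho> l where \<rho>: "strict_mono (\<rho> :: nat \<Rightarrow> nat)"
    "\<And>j. j < k \<Longrightarrow> (\<lambda>n. \<theta> (\<rho> n) j) \<longlonglongrightarrow> l j" by blast
  have "seq_compact {a..b}" by (intro compact_imp_seq_compact) simp
  then obtain x \<rho>' where \<rho>': "strict_mono (\<rho>' :: nat \<Rightarrow> nat)" "((\<lambda>n. \<theta> (\<rho> n) k) \<circ> \<rho>') \<longlonglongrightarrow> x"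
  proof (rule seq_compactE)
    show "\<forall>n. \<theta> (\<rho> n) k \<in> {a..b}" using assms by blast
  qed
  have "(\<lambda>n. \<theta> ((\<rho> \<circ> \<rho>') n) j) \<longlonglongrightarrow> (l(k := x)) j" if "j < Suc k" for j
  proof (cases "j = k")
    case True
    then show ?thesis using \<rho>'(2) by (simp add: o_def)
  next
    case False
    then have "j < k" using that by simp
    from LIMSEQ_subseq_LIMSEQ[OF \<rho>(2)[OF this] \<rho>'(1)] show ?thesis
      using False by (simp add: o_def)
  qed
  then show ?case using strict_mono_o[OF \<rho>(1) \<rho>'(1)] by blast
qed

text \<open>
  Bogolyubov's theorem for a set of natural numbers with gaps of length at most \<open>L\<close>: its twofold
  sums minus its twofold sums contain a Bohr set. The initial segments \<open>S \<inter> {..<n * L}\<close> have density at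
  least \<open>1 / L\<close>, so for each of them at most \<open>k = 32 L\<^sup>2\<close> frequencies suffice. As \<open>k\<close> does not depend on
  \<open>n\<close>, a subsequence of these frequency vectors converges, and the strict inequalities that
  define the limiting Bohr set hold along it for each fixed \<open>x\<close>.
\<close>

lemma bogolyubov_syndetic:
  fixes S :: "nat set"
  assumes L: "L > 0" and S: "\<And>a. \<exists>m\<in>S. a \<le> m \<and> m < a + L"
  shows "\<exists>R. finite R \<and> R \<subseteq> {0..2 * pi} \<and>
    (\<forall>x :: nat. real x \<in> bohr_set R 1 \<longrightarrow> (\<exists>a\<in>S. \<exists>b\<in>S. \<exists>c\<in>S. \<exists>d\<in>S. x + a + b = c + d))"
proof -
  define k where "k = 32 * L\<^sup>2"
  have "\<exists>\<theta>. (\<forall>j. \<theta> j \<in> {0..2 * pi}) \<and> (\<forall>x<2 * (n * L). real x \<in> bohr_set (\<theta> ` {..<k}) 1 \<longrightarrow>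
      (\<exists>a\<in>S. \<exists>b\<in>S. \<exists>c\<in>S. \<exists>d\<in>S. x + a + b = c + d))" for n
  proof (cases "n = 0")
    case True
    then show ?thesis by (intro exI[of _ "\<lambda>_. 0"]) simp
  next
    case False
    define A where "A = S \<inter> {..<n * L}"
    obtain m where m: "\<And>a. m a \<in> S" "\<And>a. a \<le> m a" "\<And>a. m a < a + L" using S by metis
    have "card {..<n} \<le> card A"
    proof (rule card_inj_on_le[of "\<lambda>i. m (i * L)"])
      have div: "m (i * L) div L = i" for i
        using m(2,3)[of "i * L"] L by (intro div_nat_eqI) (auto simp: mult.commute)
      show "inj_on (\<lambda>i. m (i * L)) {..<n}"
      proof (rule inj_onI)
        fix i j assume "m (i * L) = m (j * L)"
        then have "m (i * L) div L = m (j * L) div L" by (rule arg_cong)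
        then show "i = j" by (simp only: div)
      qed
      have "m (i * L) < n * L" if "i < n" for i
        unfolding div_less_iff_less_mult[OF L, symmetric] div by (rule that)
      then show "(\<lambda>i. m (i * L)) ` {..<n} \<subseteq> A" using m(1) by (auto simp: A_def)
      show "finite A" by (simp add: A_def)
    qed
    then have "n \<le> card A" by simp
    then have "n * L \<le> L * card A" by (simp add: mult.commute)
    then have "real (n * L) \<le> real L * real (card A)" by (metis of_nat_mono of_nat_mult)
    moreover have "A \<noteq> {}" using \<open>n \<le> card A\<close> False by auto
    ultimately obtain \<Theta> where \<Theta>: "finite \<Theta>" "\<Theta> \<subseteq> {0..2 * pi}" "real (card \<Theta>) \<le> 32 * (real L)\<^sup>2"
      "\<And>x. x < 2 * (n * L) \<Longrightarrow> real x \<in> bohr_set \<Theta> 1 \<Longrightarrow>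
        (\<exists>a\<in>A. \<exists>b\<in>A. \<exists>c\<in>A. \<exists>d\<in>A. x + a + b = c + d)"
      using bogolyubov_cyclic[of A "n * L" "real L"] L by (auto simp: A_def)
    have "real (card \<Theta>) \<le> real k" using \<Theta>(3) by (simp add: k_def)
    then have ck: "card \<Theta> \<le> k" by simp
    obtain h where h: "bij_betw h {0..<card \<Theta>} \<Theta>"
      using ex_bij_betw_nat_finite[OF \<Theta>(1)] by blast
    \<comment> \<open>Unused slots carry the frequency zero, which imposes no condition.\<close>
    define \<theta> where "\<theta> j = (if j < card \<Theta> then h j else 0)" for j
    have "\<Theta> \<subseteq> \<theta> ` {..<k}"
    proof
      fix x assume "x \<in> \<Theta>"
      then obtain j where "j < card \<Theta>" "x = h j"
        using h unfolding bij_betw_def by (metis atLeastLessThan_iff imageE)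
      then show "x \<in> \<theta> ` {..<k}" using ck by (intro image_eqI[of _ _ j]) (auto simp: \<theta>_def)
    qed
    then have sub: "bohr_set (\<theta> ` {..<k}) 1 \<subseteq> bohr_set \<Theta> 1" by (auto simp: bohr_set_def)
    have "\<theta> j \<in> {0..2 * pi}" for j
    proof (cases "j < card \<Theta>")
      case True
      then have "h j \<in> \<Theta>" using bij_betwE[OF h] by simp
      then show ?thesis using \<Theta>(2) True by (auto simp: \<theta>_def)
    qed (simp add: \<theta>_def)
    then show ?thesis
    proof (intro exI[of _ \<theta>] conjI allI impI)
      fix x assume "x < 2 * (n * L)" "real x \<in> bohr_set (\<theta> ` {..<k}) 1"
      then have "\<exists>a\<in>A. \<exists>b\<in>A. \<exists>c\<in>A. \<exists>d\<in>A. x + a + b = c + d" using \<Theta>(4) sub by blast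
      then show "\<exists>a\<in>S. \<exists>b\<in>S. \<exists>c\<in>S. \<exists>d\<in>S. x + a + b = c + d"
        unfolding A_def by blast
    qed
  qed
  then obtain \<theta> where \<theta>: "\<And>n j. \<theta> n j \<in> {0..2 * pi}"
    "\<And>n x. x < 2 * (n * L) \<Longrightarrow> real x \<in> bohr_set (\<theta> n ` {..<k}) 1 \<Longrightarrow>
      (\<exists>a\<in>S. \<exists>b\<in>S. \<exists>c\<in>S. \<exists>d\<in>S. x + a + b = c + d)" by metis
  obtain \<rho> l where \<rho>: "strict_mono (\<rho> :: nat \<Rightarrow> nat)"
    "\<And>j. j < k \<Longrightarrow> (\<lambda>n. \<theta> (\<rho> n) j) \<longlonglongrightarrow> l j"
    using common_convergent_subsequence[of \<theta> 0 "2 * pi" k] \<theta>(1) by blast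
  show ?thesis
  proof (intro exI[of _ "l ` {..<k}"] conjI allI impI)
    show "l ` {..<k} \<subseteq> {0..2 * pi}"
    proof clarify
      fix j assume "j < k"
      show "l j \<in> {0..2 * pi}"
        by (rule closed_sequentially[OF closed_atLeastAtMost _ \<rho>(2)[OF \<open>j < k\<close>]])
          (rule \<theta>(1))
    qed
    fix x :: nat assume x: "real x \<in> bohr_set (l ` {..<k}) 1"
    have "\<forall>\<^sub>F n in sequentially. \<forall>j\<in>{..<k}. cmod (cis (\<theta> (\<rho> n) j * real x) - 1) < 1"
    proof (rule eventually_ball_finite, simp, rule ballI)
      fix j assume "j \<in> {..<k}"
      then have j: "(\<lambda>n. \<theta> (\<rho> n) j) \<longlonglongrightarrow> l j" and lt: "cmod (cis (l j * real x) - 1) < 1"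
        using \<rho>(2) x by (auto simp: bohr_set_def)
      have "(\<lambda>n. cmod (cis (\<theta> (\<rho> n) j * real x) - 1)) \<longlonglongrightarrow> cmod (cis (l j * real x) - 1)"
        by (rule isCont_tendsto_compose[OF _ j]) (simp add: cis_conv_exp)
      then show "\<forall>\<^sub>F n in sequentially. cmod (cis (\<theta> (\<rho> n) j * real x) - 1) < 1"
        using lt by (rule order_tendstoD)
    qed
    moreover have "\<forall>\<^sub>F n in sequentially. n > x" by (rule eventually_gt_at_top)
    ultimately obtain n where n: "n > x" "\<forall>j\<in>{..<k}. cmod (cis (\<theta> (\<rho> n) j * real x) - 1) < 1"
      using eventually_happens'[OF sequentially_bot eventually_conj] by blast
    have "x < n" by (rule n(1))
    also have "n \<le> \<rho> n" by (rule seq_suble[OF \<rho>(1)])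
    also have "\<rho> n \<le> 2 * (\<rho> n * L)" using L by simp
    finally have "x < 2 * (\<rho> n * L)" .
    then show "\<exists>a\<in>S. \<exists>b\<in>S. \<exists>c\<in>S. \<exists>d\<in>S. x + a + b = c + d"
      by (rule \<theta>(2)) (use n(2) in \<open>simp add: bohr_set_def\<close>)
  qed simp
qed

section \<open>Bohr sets\<close>

lemma norm_cis_minus_one_squared: "(cmod (cis x - 1))\<^sup>2 = 2 - 2 * cos x"
proof -
  have "(cmod (cis x - 1))\<^sup>2 = (cos x - 1)\<^sup>2 + (sin x)\<^sup>2"
    by (simp add: cmod_power2)
  also have "\<dots> = 2 - 2 * cos x"
    using sin_cos_squared_add[of x] by (simp add: power2_eq_square algebra_simps)
  finally show ?thesis .
qed

lemma norm_cis_minus_one_le: "cmod (cis x - 1) \<le> \<bar>x\<bar>"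
proof (rule power2_le_imp_le)
  have "(cmod (cis x - 1))\<^sup>2 = (2 * sin (x / 2))\<^sup>2"
    using cos_double_sin[of "x / 2"] by (simp add: norm_cis_minus_one_squared power_mult_distrib)
  also have "\<dots> = (\<bar>2 * sin (x / 2)\<bar>)\<^sup>2" by simp
  also have "\<dots> \<le> \<bar>x\<bar>\<^sup>2"
    using abs_sin_x_le_abs_x[of "x / 2"] by (intro power_mono) auto
  finally show "(cmod (cis x - 1))\<^sup>2 \<le> \<bar>x\<bar>\<^sup>2" .
qed simp

lemma norm_cis_diff: "cmod (cis x - cis y) = cmod (cis (x - y) - 1)"
proof -
  have "cis x - cis y = cis y * (cis (x - y) - 1)"
    by (simp add: algebra_simps cis_mult)
  then show ?thesis by (simp add: norm_mult)
qed

lemma norm_cis_add_minus_one_le: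
  "cmod (cis (x + y) - 1) \<le> cmod (cis x - 1) + cmod (cis y - 1)"
proof -
  have "cis (x + y) - 1 = cis y * (cis x - 1) + (cis y - 1)"
    by (simp add: algebra_simps cis_mult)
  then have "cmod (cis (x + y) - 1) \<le> cmod (cis y * (cis x - 1)) + cmod (cis y - 1)"
    by (simp only: norm_triangle_ineq)
  then show ?thesis by (simp add: norm_mult)
qed

lemma relatively_dense_mono:
  assumes "relatively_dense S" "S \<subseteq> T"
  shows "relatively_dense T"
  using assms unfolding relatively_dense_def by blast

text \<open>
  Pigeonhole principle: rounding the values \<open>cis (r * t)\<close> gives each \<open>t\<close> one of finitely many codes
  \<open>q t\<close>, and two points with the same code differ by an element of the Bohr set. Hence every \<open>t\<close>
  is moved into the Bohr set by one of finitely many shifts.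
\<close>

lemma bohr_set_relatively_dense:
  assumes R: "finite R" and \<delta>: "\<delta> > 0"
  shows "relatively_dense {t. t > 0 \<and> t \<in> bohr_set R \<delta>}"
proof -
  define N where "N = 2 / \<delta>"
  have N: "N > 0" using \<delta> by (simp add: N_def)
  define q where "q t = (\<lambda>r\<in>R. (\<lfloor>cos (r * t) * N\<rfloor>, \<lfloor>sin (r * t) * N\<rfloor>))" for t
  have close: "cmod (cis (r * t) - cis (r * x)) < \<delta>" if "q t = q x" "r \<in> R" for t x r
  proof -
    have "q t r = q x r" using that(1) by simp
    then have fl: "\<lfloor>cos (r * t) * N\<rfloor> = \<lfloor>cos (r * x) * N\<rfloor>" "\<lfloor>sin (r * t) * N\<rfloor> = \<lfloor>sin (r * x) * N\<rfloor>"
      using that(2) by (auto simp: q_def)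
    have diff: "\<bar>u - v\<bar> < \<delta> / 2" if "\<lfloor>u * N\<rfloor> = \<lfloor>v * N\<rfloor>" for u v
    proof -
      have "\<bar>u * N - v * N\<bar> < 1" using that by linarith
      then have "\<bar>u - v\<bar> * N < 1" using N by (simp add: abs_mult flip: left_diff_distrib)
      then show ?thesis using \<delta> by (simp add: N_def field_simps)
    qed
    have "cmod (cis (r * t) - cis (r * x))
        \<le> \<bar>cos (r * t) - cos (r * x)\<bar> + \<bar>sin (r * t) - sin (r * x)\<bar>"
      using cmod_le[of "cis (r * t) - cis (r * x)"] by simp
    also have "\<dots> < \<delta> / 2 + \<delta> / 2" by (intro add_strict_mono diff fl)
    finally show ?thesis by simp
  qed
  have "finite (q ` UNIV)"
  proof (rule finite_subset)
    define m where "m = \<lceil>N\<rceil>"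
    have fl: "\<lfloor>u * N\<rfloor> \<in> {- m..m}" if "\<bar>u\<bar> \<le> 1" for u
    proof -
      have "\<bar>u * N\<bar> \<le> 1 * N" unfolding abs_mult using that N by (intro mult_mono) auto
      then show ?thesis unfolding m_def by (auto; linarith)
    qed
    show "q ` UNIV \<subseteq> PiE R (\<lambda>_. {- m..m} \<times> {- m..m})"
    proof (intro image_subsetI)
      fix t show "q t \<in> PiE R (\<lambda>_. {- m..m} \<times> {- m..m})"
        unfolding q_def using fl[of "cos (_ * t)"] fl[of "sin (_ * t)"]
        by (intro restrict_PiE_iff[THEN iffD2] ballI SigmaI) auto
    qed
    show "finite (PiE R (\<lambda>_. {- m..m} \<times> {- m..m}))"
      using R by (intro finite_PiE) auto
  qed
  then obtain X where X: "finite X" "q ` UNIV = q ` X"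
    using finite_subset_image[of "q ` UNIV" q UNIV] by blast
  obtain b where b: "b > 0" "\<And>x. x \<in> X \<Longrightarrow> \<bar>x\<bar> \<le> b"
    using finite_imp_bounded[OF X(1)] unfolding bounded_pos real_norm_def by blast
  show ?thesis
    unfolding relatively_dense_def
  proof (intro exI[of _ "2 * b + 1"] conjI allI impI)
    fix a :: real assume a: "a \<ge> 0"
    define t where "t = a + b + 1"
    have "q t \<in> q ` X" unfolding X(2)[symmetric] by simp
    then obtain x where x: "x \<in> X" "q t = q x" by blast
    have "t - x \<in> bohr_set R \<delta>"
      using close[OF x(2)] by (simp add: bohr_set_def norm_cis_diff right_diff_distrib)
    moreover have "t - x \<in> {a..a + (2 * b + 1)}" "t - x > 0"
      using b(2)[OF x(1)] a by (auto simp: t_def)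
    ultimately show "{a..a + (2 * b + 1)} \<inter> {t. t > 0 \<and> t \<in> bohr_set R \<delta>} \<noteq> {}" by blast
  qed (use b in simp)
qed

section \<open>Almost periodicity as uniform continuity\<close>

text \<open>
  Uniform continuity of \<open>f\<close> for the topology that \<open>\<real>\<close> inherits from its Bohr compactification. Only
  forward shifts occur, so that the notion applies to the half-line as well. In contrast to relative
  density of the translation numbers, it is visibly stable under finite intersections, hence
  under sums.
\<close>

definition bohr_uniform :: "real set \<Rightarrow> (real \<Rightarrow> 'e :: real_normed_vector) \<Rightarrow> bool"
  where "bohr_uniform I f \<longleftrightarrow> (\<forall>\<epsilon>>0. \<exists>R \<delta>. finite R \<and> \<delta> > 0 \<and>
    (\<forall>\<tau>\<ge>0. \<tau> \<in> bohr_set R \<delta> \<longrightarrow> (\<forall>t\<in>I. norm (f (t + \<tau>) - f t) \<le> \<epsilon>)))"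

lemma bohr_uniformE:
  assumes "bohr_uniform I f" "\<epsilon> > 0"
  obtains R \<delta> where "finite R" "\<delta> > 0"
    "\<And>\<tau> t. \<tau> \<ge> 0 \<Longrightarrow> \<tau> \<in> bohr_set R \<delta> \<Longrightarrow> t \<in> I \<Longrightarrow> norm (f (t + \<tau>) - f t) \<le> \<epsilon>"
proof -
  obtain R \<delta> where R: "finite R" "\<delta> > 0"
    "\<forall>\<tau>\<ge>0. \<tau> \<in> bohr_set R \<delta> \<longrightarrow> (\<forall>t\<in>I. norm (f (t + \<tau>) - f t) \<le> \<epsilon>)"
    using assms(1)[unfolded bohr_uniform_def, rule_format, OF assms(2)] by (elim exE conjE)
  show thesis by (rule that[OF R(1,2)]) (use R(3) in simp)
qed

text \<open>
  By uniform continuity translation numbers may be rounded to multiples of a small step \<open>h\<close>. The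
  multiples so obtained have bounded gaps, so Bogolyubov's theorem yields a Bohr set of integers
  \<open>m\<close> with \<open>m + a + b = c + d\<close>, where \<open>h * a\<close>, \<open>h * b\<close>, \<open>h * c\<close>, \<open>h * d\<close> are translation numbers;
  then so is \<open>h * m\<close>, with four times the error. The further frequency \<open>2 pi / h\<close> forces \<open>\<tau>\<close> to be
  close to a multiple of \<open>h\<close>.
\<close>

lemma AP_imp_bohr_uniform:
  fixes f :: "real \<Rightarrow> 'e :: complex_banach"
  assumes I: "I = UNIV \<or> I = {0..}" and f: "f \<in> AP I"
  shows "bohr_uniform I f"
  unfolding bohr_uniform_def
proof (intro allI impI)
  fix \<epsilon> :: real assume "\<epsilon> > 0"
  \<comment> \<open>Each of the four rounded translation numbers costs \<open>2 * e\<close>, and rounding \<open>\<tau>\<close> costs another \<open>e\<close>.\<close>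
  define e where "e = \<epsilon> / 9"
  have e: "e > 0" using \<open>\<epsilon> > 0\<close> by (simp add: e_def)
  obtain h where h: "h > 0"
    "\<And>s t. s \<in> I \<Longrightarrow> t \<in> I \<Longrightarrow> \<bar>s - t\<bar> \<le> h \<Longrightarrow> norm (f s - f t) \<le> e"
    using AP_uniformly_continuous[OF I f e] by blast
  define S where "S = {m :: nat. \<forall>t\<in>I. norm (f (t + h * m) - f t) \<le> 2 * e}"
  have addI: "t + u \<in> I" if "t \<in> I" "u \<ge> 0" for t u
    by (rule half_line_add_closed[OF I that])

  have "relatively_dense {\<tau>. \<tau> > 0 \<and> (\<forall>t\<in>I. norm (f (t + \<tau>) - 1 *\<^sub>C f t) \<le> e)}"
    using f e unfolding AP_def c_almost_periodic_def by blast
  then obtain l where l: "l > 0" "\<And>a. a \<ge> 0 \<Longrightarrow> {a..a + l} \<inter>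
      {\<tau>. \<tau> > 0 \<and> (\<forall>t\<in>I. norm (f (t + \<tau>) - 1 *\<^sub>C f t) \<le> e)} \<noteq> {}"
    unfolding relatively_dense_def by (elim exE conjE) blast
  define L where "L = nat \<lceil>l / h\<rceil> + 2"
  have syndetic: "\<exists>m\<in>S. a \<le> m \<and> m < a + L" for a
  proof -
    have "h * a \<ge> 0" using h by simp
    then obtain \<tau> where \<tau>: "\<tau> \<in> {h * a..h * a + l}"
      "\<tau> > 0" "\<And>t. t \<in> I \<Longrightarrow> norm (f (t + \<tau>) - 1 *\<^sub>C f t) \<le> e"
      using l(2)[of "h * a"] by blast
    define m where "m = nat \<lfloor>\<tau> / h\<rfloor>"
    have m: "real m \<le> \<tau> / h" "\<tau> / h < real m + 1"
      using \<tau>(2) h(1) by (auto simp: m_def)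
    have "norm (f (t + h * m) - f t) \<le> 2 * e" if t: "t \<in> I" for t
    proof -
      have "\<bar>t + h * m - (t + \<tau>)\<bar> \<le> h" using m h(1) by (simp add: field_simps)
      then have "norm (f (t + h * m) - f (t + \<tau>)) \<le> e"
        using t h(1) \<tau>(2) by (intro h(2) addI) auto
      moreover have "norm (f (t + \<tau>) - f t) \<le> e" using \<tau>(3)[OF t] by (simp add: scaleC_one)
      ultimately show ?thesis by norm
    qed
    then have "m \<in> S" by (simp add: S_def)
    moreover have "a \<le> m"
    proof -
      have "real a \<le> \<tau> / h" using \<tau>(1) h(1) by (simp add: field_simps)
      then have "real a < real m + 1" using m by linarith
      then show ?thesis by linarith
    qed
    moreover have "m < a + L"
    proof -
      have "\<tau> / h \<le> a + l / h" using \<tau>(1) h(1) by (simp add: field_simps)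
      also have "\<dots> \<le> a + real (nat \<lceil>l / h\<rceil>)" by linarith
      finally have "real m \<le> a + real (nat \<lceil>l / h\<rceil>)" using m by linarith
      then show ?thesis by (simp add: L_def)
    qed
    ultimately show ?thesis by blast
  qed
  have "L > 0" by (simp add: L_def)
  then obtain R where R: "finite R" "R \<subseteq> {0..2 * pi}"
    "\<And>x :: nat. real x \<in> bohr_set R 1 \<Longrightarrow> \<exists>a\<in>S. \<exists>b\<in>S. \<exists>c\<in>S. \<exists>d\<in>S. x + a + b = c + d"
    using bogolyubov_syndetic[OF _ syndetic] by blast
  define R' where "R' = insert (2 * pi / h) ((\<lambda>\<theta>. \<theta> / h) ` R)"
  define \<delta> where "\<delta> = min (1 / 2) (cmod (cis (1 / 2) - 1))"
  have \<delta>: "\<delta> > 0"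
  proof -
    have "cos (1 / 2 :: real) < cos 0"
      by (rule cos_monotone_0_pi) (use pi_gt3 in auto)
    then have "(cmod (cis (1 / 2) - 1))\<^sup>2 > 0"
      unfolding norm_cis_minus_one_squared by simp
    then show ?thesis by (simp add: \<delta>_def)
  qed
  have "norm (f (t + \<tau>) - f t) \<le> \<epsilon>"
    if \<tau>: "\<tau> \<ge> 0" "\<tau> \<in> bohr_set R' \<delta>" and t: "t \<in> I" for \<tau> t
  proof -
    define u where "u = \<tau> / h - of_int (round (\<tau> / h))"
    define m where "m = nat (round (\<tau> / h))"
    have "round (\<tau> / h) \<ge> 0" using \<tau>(1) h(1) by (simp add: round_def)
    then have m: "\<tau> / h = real m + u" by (simp add: m_def u_def)
    have u: "\<bar>u\<bar> \<le> 1 / 2"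
      using of_int_round_abs_le[of "\<tau> / h"] by (simp add: u_def abs_minus_commute)
    have "cis (2 * pi * u) = cis (2 * pi / h * \<tau>)"
    proof -
      have "2 * pi / h * \<tau> = 2 * pi * (\<tau> / h)" by simp
      also have "\<dots> = 2 * pi * u + 2 * pi * real m"
        unfolding m by (simp add: algebra_simps)
      finally have "2 * pi / h * \<tau> = 2 * pi * u + 2 * pi * real m" .
      then show ?thesis by (simp flip: cis_mult)
    qed
    then have small: "cmod (cis (2 * pi * u) - 1) < \<delta>"
      using \<tau>(2) by (auto simp: bohr_set_def R'_def)
    \<comment> \<open>The cosine is decreasing on \<open>{0..pi}\<close>, so \<open>\<delta> \<le> \<bar>cis (1 / 2) - 1\<bar>\<close> confines the angle.\<close>
    have u2: "\<bar>2 * pi * u\<bar> < 1 / 2"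
    proof (rule ccontr)
      assume "\<not> ?thesis"
      then have "cos \<bar>2 * pi * u\<bar> \<le> cos (1 / 2)"
        using u by (intro cos_monotone_0_pi_le) (auto simp: abs_mult)
      then have "(cmod (cis (1 / 2) - 1))\<^sup>2 \<le> (cmod (cis (2 * pi * u) - 1))\<^sup>2"
        by (simp add: norm_cis_minus_one_squared)
      then have "cmod (cis (1 / 2) - 1) \<le> cmod (cis (2 * pi * u) - 1)"
        by (rule power2_le_imp_le) simp
      then show False using small by (simp add: \<delta>_def)
    qed
    have "cmod (cis (\<theta> * real m) - 1) < 1" if \<theta>: "\<theta> \<in> R" for \<theta>
    proof -
      have "\<theta> / h * \<tau> = \<theta> * (\<tau> / h)" by simp
      also have "\<dots> = \<theta> * real m + \<theta> * u" unfolding m by (simp add: algebra_simps)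
      finally have "\<theta> * real m = \<theta> / h * \<tau> + - (\<theta> * u)" by simp
      then have "cmod (cis (\<theta> * real m) - 1)
          \<le> cmod (cis (\<theta> / h * \<tau>) - 1) + cmod (cis (- (\<theta> * u)) - 1)"
        using norm_cis_add_minus_one_le by metis
      also have "cmod (cis (- (\<theta> * u)) - 1) \<le> \<bar>\<theta>\<bar> * \<bar>u\<bar>"
        using norm_cis_minus_one_le[of "- (\<theta> * u)"] by (simp add: abs_mult)
      also have "\<bar>\<theta>\<bar> * \<bar>u\<bar> \<le> 2 * pi * \<bar>u\<bar>"
        using \<theta> R(2) by (intro mult_right_mono) auto
      also have "2 * pi * \<bar>u\<bar> < 1 / 2" using u2 by (simp add: abs_mult)
      also have "cmod (cis (\<theta> / h * \<tau>) - 1) < 1 / 2"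
        using \<tau>(2) \<theta> by (auto simp: bohr_set_def R'_def \<delta>_def)
      finally show ?thesis by simp
    qed
    then obtain a b c d where abcd: "a \<in> S" "b \<in> S" "c \<in> S" "d \<in> S" "m + a + b = c + d"
      using R(3)[of m] by (auto simp: bohr_set_def)
    have step: "norm (f (s + h * real k) - f s) \<le> 2 * e" if "k \<in> S" "s \<in> I" for k s
      using that by (simp add: S_def)
    have pos: "h * real k \<ge> 0" for k using h(1) by simp
    define p where "p = f (t + h * c + h * d)"
    have same: "t + h * m + h * a + h * b = t + h * c + h * d"
    proof -
      have "real m + real a + real b = real c + real d"
        using abcd(5) by (metis of_nat_add)
      then have "h * (real m + real a + real b) = h * (real c + real d)" by simp
      then show ?thesis by (simp add: algebra_simps)
    qed
    have "norm (p - f (t + h * m + h * a)) \<le> 2 * e"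
      "norm (f (t + h * m + h * a) - f (t + h * m)) \<le> 2 * e"
      unfolding p_def same[symmetric] by (intro step abcd addI t pos)+
    then have "norm (p - f (t + h * m)) \<le> 2 * e + 2 * e"
      by (rule norm_diff_triangle_le)
    moreover have "norm (p - f (t + h * c)) \<le> 2 * e" "norm (f (t + h * c) - f t) \<le> 2 * e"
      unfolding p_def by (intro step abcd addI t pos)+
    then have "norm (p - f t) \<le> 2 * e + 2 * e"
      by (rule norm_diff_triangle_le)
    moreover have "norm (f (t + \<tau>) - f (t + h * m)) \<le> e"
    proof (rule h(2))
      show "t + \<tau> \<in> I" "t + h * m \<in> I" using t \<tau>(1) pos by (auto intro: addI)
      have "\<tau> = h * m + h * u" using m h(1) by (simp add: field_simps)
      then show "\<bar>t + \<tau> - (t + h * m)\<bar> \<le> h" using u h(1) by (simp add: abs_mult)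
    qed
    ultimately have "norm (f (t + \<tau>) - f t) \<le> 9 * e" by norm
    then show ?thesis by (simp add: e_def)
  qed
  then show "\<exists>R \<delta>. finite R \<and> \<delta> > 0 \<and>
      (\<forall>\<tau>\<ge>0. \<tau> \<in> bohr_set R \<delta> \<longrightarrow> (\<forall>t\<in>I. norm (f (t + \<tau>) - f t) \<le> \<epsilon>))"
    using \<delta> R(1) by (intro exI[of _ R'] exI[of _ \<delta>]) (simp add: R'_def)
qed

lemma AP_iff_bohr_uniform:
  fixes f :: "real \<Rightarrow> 'e :: complex_banach"
  assumes I: "I = UNIV \<or> I = {0..}"
  shows "f \<in> AP I \<longleftrightarrow> (\<forall>t. t \<notin> I \<longrightarrow> f t = 0) \<and> continuous_on I f \<and> bohr_uniform I f"
proof (intro iffI conjI)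
  assume "f \<in> AP I"
  then show "\<forall>t. t \<notin> I \<longrightarrow> f t = 0" "continuous_on I f" "bohr_uniform I f"
    using AP_imp_bohr_uniform[OF I] by (auto simp: AP_def c_almost_periodic_def)
next
  assume f: "(\<forall>t. t \<notin> I \<longrightarrow> f t = 0) \<and> continuous_on I f \<and> bohr_uniform I f"
  have "relatively_dense {\<tau>. \<tau> > 0 \<and> (\<forall>t\<in>I. norm (f (t + \<tau>) - 1 *\<^sub>C f t) \<le> \<epsilon>)}"
    if e: "\<epsilon> > 0" for \<epsilon>
  proof -
    obtain R \<delta> where R: "finite R" "\<delta> > 0"
      "\<And>\<tau> t. \<tau> \<ge> 0 \<Longrightarrow> \<tau> \<in> bohr_set R \<delta> \<Longrightarrow> t \<in> I \<Longrightarrow> norm (f (t + \<tau>) - f t) \<le> \<epsilon>"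
      using bohr_uniformE[OF _ e] f by blast
    show ?thesis
      by (rule relatively_dense_mono[OF bohr_set_relatively_dense[OF R(1,2)]])
        (use R(3) in \<open>auto simp: scaleC_one\<close>)
  qed
  then show "f \<in> AP I" using f by (simp add: AP_def c_almost_periodic_def)
qed

lemma bohr_uniform_add:
  assumes "bohr_uniform I f" "bohr_uniform I g"
  shows "bohr_uniform I (\<lambda>t. f t + g t)"
  unfolding bohr_uniform_def
proof (intro allI impI)
  fix \<epsilon> :: real assume "\<epsilon> > 0"
  then have e: "\<epsilon> / 2 > 0" by simp
  obtain R \<delta> where R: "finite R" "\<delta> > 0"
    "\<And>\<tau> t. \<tau> \<ge> 0 \<Longrightarrow> \<tau> \<in> bohr_set R \<delta> \<Longrightarrow> t \<in> I \<Longrightarrow> norm (f (t + \<tau>) - f t) \<le> \<epsilon> / 2"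
    using bohr_uniformE[OF assms(1) e] by blast
  obtain R' \<delta>' where R': "finite R'" "\<delta>' > 0"
    "\<And>\<tau> t. \<tau> \<ge> 0 \<Longrightarrow> \<tau> \<in> bohr_set R' \<delta>' \<Longrightarrow> t \<in> I \<Longrightarrow> norm (g (t + \<tau>) - g t) \<le> \<epsilon> / 2"
    using bohr_uniformE[OF assms(2) e] by blast
  have "norm (f (t + \<tau>) + g (t + \<tau>) - (f t + g t)) \<le> \<epsilon>"
    if "\<tau> \<ge> 0" "\<tau> \<in> bohr_set (R \<union> R') (min \<delta> \<delta>')" "t \<in> I" for \<tau> t
  proof -
    have "\<tau> \<in> bohr_set R \<delta>" "\<tau> \<in> bohr_set R' \<delta>'"
      using that(2) by (auto simp: bohr_set_def)
    then have "norm (f (t + \<tau>) - f t) \<le> \<epsilon> / 2" "norm (g (t + \<tau>) - g t) \<le> \<epsilon> / 2"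
      using R(3) R'(3) that by auto
    then show ?thesis by norm
  qed
  then show "\<exists>R \<delta>. finite R \<and> \<delta> > 0 \<and> (\<forall>\<tau>\<ge>0. \<tau> \<in> bohr_set R \<delta> \<longrightarrow>
      (\<forall>t\<in>I. norm (f (t + \<tau>) + g (t + \<tau>) - (f t + g t)) \<le> \<epsilon>))"
    using R R' by (intro exI[of _ "R \<union> R'"] exI[of _ "min \<delta> \<delta>'"]) simp
qed

lemma bohr_uniform_scaleC:
  assumes "bohr_uniform I f"
  shows "bohr_uniform I (\<lambda>t. a *\<^sub>C f t)"
  unfolding bohr_uniform_def
proof (intro allI impI)
  fix \<epsilon> :: real assume \<epsilon>: "\<epsilon> > 0"
  then have "\<epsilon> / (cmod a + 1) > 0" by (simp add: add_nonneg_pos)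
  from bohr_uniformE[OF assms this] obtain R \<delta> where R: "finite R" "\<delta> > 0"
    "\<And>\<tau> t. \<tau> \<ge> 0 \<Longrightarrow> \<tau> \<in> bohr_set R \<delta> \<Longrightarrow> t \<in> I \<Longrightarrow> norm (f (t + \<tau>) - f t) \<le> \<epsilon> / (cmod a + 1)"
    by blast
  have "norm (a *\<^sub>C f (t + \<tau>) - a *\<^sub>C f t) \<le> \<epsilon>"
    if "\<tau> \<ge> 0" "\<tau> \<in> bohr_set R \<delta>" "t \<in> I" for \<tau> t
  proof -
    have "norm (a *\<^sub>C f (t + \<tau>) - a *\<^sub>C f t) = cmod a * norm (f (t + \<tau>) - f t)"
      by (simp add: norm_scaleC flip: scaleC.diff_right)
    also have "\<dots> \<le> (cmod a + 1) * (\<epsilon> / (cmod a + 1))"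
      using R(3)[OF that] by (intro mult_mono) auto
    also have "\<dots> = \<epsilon>"
    proof -
      have "cmod a + 1 \<noteq> 0" using norm_ge_zero[of a] by linarith
      then show ?thesis by simp
    qed
    finally show ?thesis .
  qed
  then show "\<exists>R \<delta>. finite R \<and> \<delta> > 0 \<and> (\<forall>\<tau>\<ge>0. \<tau> \<in> bohr_set R \<delta> \<longrightarrow>
      (\<forall>t\<in>I. norm (a *\<^sub>C f (t + \<tau>) - a *\<^sub>C f t) \<le> \<epsilon>))"
    using R by blast
qed

lemma bohr_uniform_cis:
  assumes f: "bohr_uniform I f" and B: "B > 0" "\<And>t. t \<in> I \<Longrightarrow> norm (f t) \<le> B"
  shows "bohr_uniform I (\<lambda>t. cis (r * t) *\<^sub>C f t)"
  unfolding bohr_uniform_def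
proof (intro allI impI)
  fix \<epsilon> :: real assume \<epsilon>: "\<epsilon> > 0"
  then have "\<epsilon> / 2 > 0" by simp
  from bohr_uniformE[OF f this] obtain R \<delta> where R: "finite R" "\<delta> > 0"
    "\<And>\<tau> t. \<tau> \<ge> 0 \<Longrightarrow> \<tau> \<in> bohr_set R \<delta> \<Longrightarrow> t \<in> I \<Longrightarrow> norm (f (t + \<tau>) - f t) \<le> \<epsilon> / 2"
    by blast
  define \<delta>' where "\<delta>' = min \<delta> (\<epsilon> / (2 * B))"
  have "norm (cis (r * (t + \<tau>)) *\<^sub>C f (t + \<tau>) - cis (r * t) *\<^sub>C f t) \<le> \<epsilon>"
    if \<tau>: "\<tau> \<ge> 0" "\<tau> \<in> bohr_set (insert r R) \<delta>'" and t: "t \<in> I" for \<tau> t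
  proof -
    have "cis (r * (t + \<tau>)) *\<^sub>C f (t + \<tau>) - cis (r * t) *\<^sub>C f t
        = cis (r * (t + \<tau>)) *\<^sub>C (f (t + \<tau>) - f t) + (cis (r * (t + \<tau>)) - cis (r * t)) *\<^sub>C f t"
      by (simp add: scaleC.diff_right scaleC.diff_left)
    also have "norm \<dots> \<le> norm (f (t + \<tau>) - f t) + cmod (cis (r * (t + \<tau>)) - cis (r * t)) * norm (f t)"
      by (rule order_trans[OF norm_triangle_ineq]) (simp add: norm_scaleC)
    also have "cmod (cis (r * (t + \<tau>)) - cis (r * t)) = cmod (cis (r * \<tau>) - 1)"
      by (simp add: norm_cis_diff algebra_simps)
    also have "cmod (cis (r * \<tau>) - 1) * norm (f t) \<le> \<epsilon> / (2 * B) * B"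
      using \<tau>(2) B t \<epsilon> by (intro mult_mono) (auto simp: bohr_set_def \<delta>'_def)
    also have "\<epsilon> / (2 * B) * B = \<epsilon> / 2" using B by simp
    also have "norm (f (t + \<tau>) - f t) \<le> \<epsilon> / 2"
      using \<tau> t by (intro R(3)) (auto simp: bohr_set_def \<delta>'_def)
    finally show ?thesis by simp
  qed
  moreover have "\<delta>' > 0" using R(2) \<epsilon> B by (simp add: \<delta>'_def)
  ultimately show "\<exists>R \<delta>. finite R \<and> \<delta> > 0 \<and> (\<forall>\<tau>\<ge>0. \<tau> \<in> bohr_set R \<delta> \<longrightarrow>
      (\<forall>t\<in>I. norm (cis (r * (t + \<tau>)) *\<^sub>C f (t + \<tau>) - cis (r * t) *\<^sub>C f t) \<le> \<epsilon>))"
    using R(1) by (intro exI[of _ "insert r R"] exI[of _ \<delta>']) simp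
qed

lemma continuous_on_cis_times [continuous_intros]: "continuous_on S (\<lambda>t. cis (r * t))"
  unfolding cis_conv_exp by (intro continuous_intros)

lemma AP_cis:
  fixes f :: "real \<Rightarrow> 'e :: complex_banach"
  assumes I: "I = UNIV \<or> I = {0..}" and f: "f \<in> AP I"
  shows "(\<lambda>t. cis (r * t) *\<^sub>C f t) \<in> AP I"
proof -
  obtain B where B: "B > 0" "\<And>t. t \<in> I \<Longrightarrow> norm (f t) \<le> B"
    using c_ap_bounded[OF I norm_one] f unfolding AP_def by blast
  show ?thesis
    using f bohr_uniform_cis[OF _ B] unfolding AP_iff_bohr_uniform[OF I]
    by (auto simp: scaleC.zero_right intro!: scaleC.continuous_on continuous_on_cis_times)
qed

lemma AP_subspace:
  assumes I: "I = UNIV \<or> I = {0..}"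
  shows "cfun.subspace (AP I :: (real \<Rightarrow> 'e :: complex_banach) set)"
proof (rule cfun.subspaceI)
  show "(0 :: real \<Rightarrow> 'e) \<in> AP I"
    unfolding AP_iff_bohr_uniform[OF I]
    by (auto simp: bohr_uniform_def zero_fun_def intro!: exI[of _ "{}"] exI[of _ "1 :: real"])
  fix f g :: "real \<Rightarrow> 'e" and a :: complex
  assume f: "f \<in> AP I"
  show "(\<lambda>t. a *\<^sub>C f t) \<in> AP I"
    using f unfolding AP_iff_bohr_uniform[OF I]
    by (auto simp: scaleC.zero_right intro!: scaleC.continuous_on bohr_uniform_scaleC)
  assume g: "g \<in> AP I"
  show "f + g \<in> AP I"
    using f g unfolding AP_iff_bohr_uniform[OF I] plus_fun_def
    by (auto intro!: continuous_on_add bohr_uniform_add)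
qed

section \<open>Mean values\<close>

lemma AP_continuous_shift:
  assumes I: "I = UNIV \<or> I = {0..}" and f: "f \<in> AP I" and t: "t \<in> I"
  shows "continuous_on {0..} (\<lambda>u :: real. f (t + u))"
proof -
  have "continuous_on I f" using f by (simp add: AP_def c_almost_periodic_def)
  then show ?thesis
  proof (rule continuous_on_compose2)
    show "(+) t ` {0..} \<subseteq> I" using half_line_add_closed[OF I t] by (meson atLeast_iff image_subsetI)
  qed (intro continuous_intros)
qed

lemma average_const:
  assumes "T > 0"
  shows "average (\<lambda>_. x :: 'a :: banach) T = x"
  using assms by (simp add: average_def)

lemma average_swap:
  fixes F :: "real \<Rightarrow> real \<Rightarrow> 'a :: banach"
  assumes "continuous_on ({0..S} \<times> {0..T}) (\<lambda>(s, t). F s t)"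
  shows "average (\<lambda>s. average (F s) T) S = average (\<lambda>t. average (\<lambda>s. F s t) S) T"
proof -
  have "integral {0..S} (\<lambda>s. integral {0..T} (F s)) = integral {0..T} (\<lambda>t. integral {0..S} (\<lambda>s. F s t))"
    using integral_swap_continuous[of 0 0 S T F] assms by (simp add: cbox_Pair_eq)
  then show ?thesis by (simp add: average_def mult.commute)
qed

text \<open>
  The averages over windows of length \<open>T\<close> depend little on the starting point once \<open>T\<close> is large. The
  averages over lengths \<open>S\<close> and \<open>T\<close> are both close to the double average of \<open>f (s + t)\<close> over
  \<open>{0..S} \<times> {0..T}\<close>, which is symmetric by Fubini's theorem; so they form a Cauchy family.
\<close>

lemma AP_uniform_mean:
  fixes f :: "real \<Rightarrow> 'e :: complex_banach"
  assumes I: "I = UNIV \<or> I = {0..}" and f: "f \<in> AP I"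
  shows "\<exists>v. \<forall>\<epsilon>>0. \<forall>\<^sub>F T in at_top. \<forall>a\<in>I. norm (average (\<lambda>s. f (a + s)) T - v) \<le> \<epsilon>"
proof -
  define A where "A a T = average (\<lambda>s. f (a + s)) T" for a T
  have f': "c_almost_periodic 1 I f" using f by (simp add: AP_def)
  obtain B where B: "B > 0" "\<And>t. t \<in> I \<Longrightarrow> norm (f t) \<le> B"
    using c_ap_bounded[OF I norm_one f'] by blast
  have cont: "continuous_on {0..T} (\<lambda>s. f (a + s))" if "a \<in> I" for a T
    by (rule continuous_on_subset[OF AP_continuous_shift[OF I f that]]) auto
  have sub: "{0..} \<subseteq> I" by (rule half_line_subset[OF I])
  then have I0: "0 \<in> I" by auto

  have base: "\<exists>T0>0. \<forall>T\<ge>T0. \<forall>a\<in>I. norm (A a T - A 0 T) \<le> \<epsilon>" if \<epsilon>: "\<epsilon> > 0" for \<epsilon>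
  proof -
    have e2: "\<epsilon> / 2 > 0" using \<epsilon> by simp
    obtain l where l: "l > 0" "\<And>t. t \<in> I \<Longrightarrow> \<exists>s\<in>{0..l}. \<exists>z. cmod z = 1 \<and> (1 = (1::complex) \<longrightarrow> z = 1) \<and>
        (\<forall>u\<ge>0. norm (f (t + u) - z *\<^sub>C f (s + u)) \<le> \<epsilon> / 2)"
      using c_ap_shift_to_compact[OF I norm_one f' e2] by blast
    define T0 where "T0 = 4 * l * B / \<epsilon>"
    have T0: "T0 > 0" using l B \<epsilon> by (simp add: T0_def)
    have "norm (A a T - A 0 T) \<le> \<epsilon>" if T: "T \<ge> T0" and a: "a \<in> I" for T a
    proof -
      have Tpos: "T > 0" using T T0 by simp
      obtain s z where s: "s \<in> {0..l}" "z = 1"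
        "\<forall>u\<ge>0. norm (f (a + u) - z *\<^sub>C f (s + u)) \<le> \<epsilon> / 2"
        using l(2)[OF a] by blast
      have sI: "s \<in> I" using s(1) sub by auto
      have "norm (A a T - A s T) \<le> \<epsilon> / 2"
        unfolding A_def
        by (rule average_diff_bound[OF Tpos cont[OF a] cont[OF sI]])
          (use s(2,3) in \<open>auto simp: scaleC_one\<close>)
      moreover have "norm (A s T - A 0 T) \<le> \<epsilon> / 2"
      proof -
        have "norm (average (\<lambda>t. f (s + t)) T - average f T) \<le> 2 * s * B / T"
          by (rule average_shift_bound[OF c_ap_continuous_Ici[OF I f'] B(2)])
            (use s(1) sub Tpos in auto)
        also have "\<dots> \<le> 2 * l * B / T"
          using s(1) B Tpos by (intro divide_right_mono mult_right_mono mult_left_mono) auto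
        also have "\<dots> \<le> \<epsilon> / 2"
          using T Tpos \<epsilon> by (simp add: T0_def field_simps)
        finally show ?thesis by (simp add: A_def)
      qed
      ultimately have "norm (A a T - A 0 T) \<le> \<epsilon> / 2 + \<epsilon> / 2" by (rule norm_diff_triangle_le)
      then show ?thesis by simp
    qed
    then show ?thesis using T0 by blast
  qed

  have comparable: "norm (A 0 S - A 0 T) \<le> 2 * \<epsilon>"
    if T0: "T0 > 0" "\<forall>T\<ge>T0. \<forall>a\<in>I. norm (A a T - A 0 T) \<le> \<epsilon>" and ST: "S \<ge> T0" "T \<ge> T0" for \<epsilon> T0 S T
  proof -
    have contF: "continuous_on ({0..S} \<times> {0..T}) (\<lambda>(s, t). f (s + t))" for S T
      unfolding case_prod_beta
      by (rule continuous_on_compose2[OF c_ap_continuous_Ici[OF I f']])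
        (auto intro!: continuous_intros)
    have near: "norm (average (\<lambda>s. A s T) S - A 0 T) \<le> \<epsilon>" if ST: "S \<ge> T0" "T \<ge> T0" for S T
    proof -
      have S: "S > 0" and T: "T > 0" using ST T0 by auto
      have "continuous_on {0..S} (\<lambda>s. integral (cbox 0 T) (\<lambda>t. f (s + t)))"
        using contF[of S T] by (intro integral_continuous_on_param) simp
      then have cA: "continuous_on {0..S} (\<lambda>s. A s T)"
        unfolding A_def average_def by (intro continuous_intros) simp
      have "norm (average (\<lambda>s. A s T) S - average (\<lambda>_. A 0 T) S) \<le> \<epsilon>"
        by (rule average_diff_bound[OF S cA continuous_on_const])
          (use T0(2) ST sub in auto)
      then show ?thesis by (simp add: average_const[OF S])
    qed
    have "average (\<lambda>s. A s T) S = average (\<lambda>t. A t S) T"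
      unfolding A_def by (subst average_swap[OF contF]) (simp add: add.commute)
    then have "norm (A 0 S - A 0 T) \<le> \<epsilon> + \<epsilon>"
      using near[OF ST] near[OF ST(2,1)]
      by (intro norm_diff_triangle_le[of _ "average (\<lambda>s. A s T) S"]) (simp_all add: norm_minus_commute)
    then show ?thesis by simp
  qed

  have "Cauchy (\<lambda>n. A 0 (real n))"
  proof (rule CauchyI)
    fix \<epsilon> :: real assume "\<epsilon> > 0"
    then have "\<epsilon> / 4 > 0" by simp
    from base[OF this] obtain T0 where T0: "T0 > 0"
      "\<forall>T\<ge>T0. \<forall>a\<in>I. norm (A a T - A 0 T) \<le> \<epsilon> / 4" by (elim exE conjE)
    have "norm (A 0 (real m) - A 0 (real n)) < \<epsilon>" if "m \<ge> nat \<lceil>T0\<rceil>" "n \<ge> nat \<lceil>T0\<rceil>" for m n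
    proof -
      have "real m \<ge> T0" "real n \<ge> T0" using that by linarith+
      from comparable[OF T0 this] show ?thesis using \<open>\<epsilon> > 0\<close> by simp
    qed
    then show "\<exists>M. \<forall>m\<ge>M. \<forall>n\<ge>M. norm (A 0 (real m) - A 0 (real n)) < \<epsilon>" by blast
  qed
  then obtain v where v: "(\<lambda>n. A 0 (real n)) \<longlonglongrightarrow> v"
    using Cauchy_convergent_iff convergent_def by blast
  show ?thesis
  proof (intro exI[of _ v] allI impI)
    fix \<epsilon> :: real assume "\<epsilon> > 0"
    then have "\<epsilon> / 3 > 0" by simp
    from base[OF this] obtain T0 where T0: "T0 > 0"
      "\<forall>T\<ge>T0. \<forall>a\<in>I. norm (A a T - A 0 T) \<le> \<epsilon> / 3" by (elim exE conjE)
    have "norm (A a T - v) \<le> \<epsilon>" if T: "T \<ge> T0" and a: "a \<in> I" for T a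
    proof -
      have "norm (A 0 T - v) \<le> 2 * (\<epsilon> / 3)"
      proof (rule tendsto_upperbound)
        show "(\<lambda>n. norm (A 0 T - A 0 (real n))) \<longlonglongrightarrow> norm (A 0 T - v)"
          by (intro tendsto_norm tendsto_diff tendsto_const v)
        have "\<forall>\<^sub>F n in sequentially. real n \<ge> T0"
          using filterlim_real_sequentially by (simp add: filterlim_at_top)
        then show "\<forall>\<^sub>F n in sequentially. norm (A 0 T - A 0 (real n)) \<le> 2 * (\<epsilon> / 3)"
          by eventually_elim (rule comparable[OF T0 T])
      qed simp
      moreover have "norm (A a T - A 0 T) \<le> \<epsilon> / 3" using T0(2) T a by blast
      ultimately have "norm (A a T - v) \<le> \<epsilon> / 3 + 2 * (\<epsilon> / 3)"
        by (intro norm_diff_triangle_le)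
      then show ?thesis by simp
    qed
    then show "\<forall>\<^sub>F T in at_top. \<forall>a\<in>I. norm (average (\<lambda>s. f (a + s)) T - v) \<le> \<epsilon>"
      unfolding A_def eventually_at_top_linorder by blast
  qed
qed

lemma AP_average_convergent:
  fixes f :: "real \<Rightarrow> 'e :: complex_banach"
  assumes I: "I = UNIV \<or> I = {0..}" and f: "f \<in> AP I"
  shows "\<exists>v. (average f \<longlongrightarrow> v) at_top"
proof -
  obtain v where v: "\<And>\<epsilon>. \<epsilon> > 0 \<Longrightarrow> \<forall>\<^sub>F T in at_top. \<forall>a\<in>I. norm (average (\<lambda>s. f (a + s)) T - v) \<le> \<epsilon>"
    using AP_uniform_mean[OF I f] by blast
  have I0: "0 \<in> I" using I by auto
  have "(average f \<longlongrightarrow> v) at_top"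
    unfolding tendsto_iff dist_norm
  proof (intro allI impI)
    fix \<epsilon> :: real assume "\<epsilon> > 0"
    then have "\<epsilon> / 2 > 0" by simp
    from v[OF this] show "\<forall>\<^sub>F T in at_top. norm (average f T - v) < \<epsilon>"
    proof eventually_elim
      case (elim T)
      then have "norm (average (\<lambda>s. f (0 + s)) T - v) \<le> \<epsilon> / 2" using I0 by blast
      then show ?case using \<open>\<epsilon> > 0\<close> by simp
    qed
  qed
  then show ?thesis by blast
qed

lemma bohr_coeff_0: "bohr_coeff 0 f = Lim at_top (average f)"
  unfolding bohr_coeff_def average_def by (simp add: scaleC_one)

section \<open>Trigonometric polynomials\<close>

definition trig_polynomials :: "real set \<Rightarrow> (real \<Rightarrow> 'e :: complex_banach) set"
  where "trig_polynomials \<Lambda> = cfun.span {\<lambda>t. cis (r * t) *\<^sub>C v | r v. r \<in> \<Lambda>}"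

lemma trig_polynomials_base: "r \<in> \<Lambda> \<Longrightarrow> (\<lambda>t. cis (r * t) *\<^sub>C v) \<in> trig_polynomials \<Lambda>"
  unfolding trig_polynomials_def by (rule cfun.span_base) blast

lemma trig_polynomials_zero: "(\<lambda>_. 0) \<in> trig_polynomials \<Lambda>"
  using cfun.span_zero unfolding trig_polynomials_def zero_fun_def .

lemma trig_polynomials_add:
  "p \<in> trig_polynomials \<Lambda> \<Longrightarrow> q \<in> trig_polynomials \<Lambda> \<Longrightarrow> (\<lambda>t. p t + q t) \<in> trig_polynomials \<Lambda>"
  using cfun.span_add unfolding trig_polynomials_def plus_fun_def .

lemma trig_polynomials_scaleC:
  "p \<in> trig_polynomials \<Lambda> \<Longrightarrow> (\<lambda>t. a *\<^sub>C p t) \<in> trig_polynomials \<Lambda>"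
  unfolding trig_polynomials_def by (rule cfun.span_scale)

lemma trig_polynomials_sum:
  "finite X \<Longrightarrow> (\<And>x. x \<in> X \<Longrightarrow> p x \<in> trig_polynomials \<Lambda>) \<Longrightarrow>
    (\<lambda>t. \<Sum>x\<in>X. p x t) \<in> trig_polynomials \<Lambda>"
  by (induction X rule: finite_induct) (auto intro: trig_polynomials_zero trig_polynomials_add)

lemma trig_polynomials_induct [consumes 1, case_names zero add scale base]:
  assumes p: "p \<in> trig_polynomials \<Lambda>"
    and zero: "P (\<lambda>_. 0)"
    and add: "\<And>p q. P p \<Longrightarrow> P q \<Longrightarrow> P (\<lambda>t. p t + q t)"
    and scale: "\<And>a p. P p \<Longrightarrow> P (\<lambda>t. a *\<^sub>C p t)"
    and base: "\<And>r v. r \<in> \<Lambda> \<Longrightarrow> P (\<lambda>t. cis (r * t) *\<^sub>C v)"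
  shows "P p"
  using p unfolding trig_polynomials_def
proof (rule cfun.span_induct)
  show "cfun.subspace (Collect P)"
    using zero add scale by (auto simp: cfun.subspace_def zero_fun_def plus_fun_def)
qed (use base in auto)

lemma trig_polynomials_mult:
  fixes p q :: "real \<Rightarrow> complex"
  assumes "p \<in> trig_polynomials UNIV" "q \<in> trig_polynomials UNIV"
  shows "(\<lambda>t. p t * q t) \<in> trig_polynomials UNIV"
  using assms(1)
proof (induction p rule: trig_polynomials_induct)
  case zero
  then show ?case by (simp add: trig_polynomials_zero)
next
  case (add p p')
  then show ?case using trig_polynomials_add by (fastforce simp: distrib_right)
next
  case (scale a p)
  then show ?case using trig_polynomials_scaleC[of _ _ a]
    by (fastforce simp: scaleC_complex_def mult.assoc)
next
  case (base r v)
  from assms(2) show ?case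
  proof (induction q rule: trig_polynomials_induct)
    case zero
    then show ?case by (simp add: trig_polynomials_zero)
  next
    case (add p p')
    then show ?case using trig_polynomials_add by (fastforce simp: distrib_left)
  next
    case (scale a p)
    then show ?case using trig_polynomials_scaleC[of _ _ a]
      by (fastforce simp: scaleC_complex_def mult_ac)
  next
    case (base r' v')
    have "(\<lambda>t. cis (r * t) *\<^sub>C v * cis (r' * t) *\<^sub>C v') = (\<lambda>t. cis ((r + r') * t) *\<^sub>C (v * v'))"
      by (simp add: scaleC_complex_def cis_mult[symmetric] algebra_simps)
    then show ?case using trig_polynomials_base[of "r + r'" UNIV "v * v'"] by simp
  qed
qed

lemma trig_polynomials_power:
  fixes p :: "real \<Rightarrow> complex"
  assumes "p \<in> trig_polynomials UNIV"
  shows "(\<lambda>t. p t ^ n) \<in> trig_polynomials UNIV"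
proof (induction n)
  case 0
  show ?case using trig_polynomials_base[of 0 UNIV "1 :: complex"] by (simp add: scaleC_complex_def)
next
  case (Suc n)
  then show ?case using trig_polynomials_mult[OF assms] by simp
qed

lemma trig_polynomials_cos: "(\<lambda>t. complex_of_real (cos (r * t))) \<in> trig_polynomials UNIV"
proof -
  have "(\<lambda>t. complex_of_real (cos (r * t))) =
      (\<lambda>t. cis (r * t) *\<^sub>C (1 / 2 :: complex) + cis (- r * t) *\<^sub>C (1 / 2))"
    by (auto simp: scaleC_complex_def complex_eq_iff fun_eq_iff)
  then show ?thesis by (simp only: trig_polynomials_add trig_polynomials_base UNIV_I)
qed

text \<open>
  For \<open>K s = cis (r * s)\<close> the average of \<open>K s *\<^sub>C f (t + s)\<close> is \<open>cis (- r * t)\<close> times an average of the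
  almost periodic function \<open>cis (r * u) *\<^sub>C f u\<close>, started at \<open>t\<close>. It converges uniformly in \<open>t\<close> to the
  exponential of frequency \<open>- r\<close> times the mean value of that function. For \<open>r = 0\<close> this mean value is
  the one of \<open>f\<close>, namely zero, and so the frequency zero is absent from the limit.
\<close>

lemma AP_convolution_trig_polynomial:
  fixes f :: "real \<Rightarrow> 'e :: complex_banach"
  assumes I: "I = UNIV \<or> I = {0..}" and f: "f \<in> AP I" and mean: "(average f \<longlongrightarrow> 0) at_top"
    and K: "K \<in> trig_polynomials UNIV"
  shows "\<exists>g\<in>trig_polynomials (- {0}). \<forall>\<epsilon>>0. \<forall>\<^sub>F T in at_top. \<forall>t\<in>I.
    norm (average (\<lambda>s. K s *\<^sub>C f (t + s)) T - g t) \<le> \<epsilon>"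
proof -
  define P where "P K \<longleftrightarrow> continuous_on {0..} K \<and> (\<exists>g\<in>trig_polynomials (- {0}). \<forall>\<epsilon>>0. \<forall>\<^sub>F T in at_top. \<forall>t\<in>I.
    norm (average (\<lambda>s. K s *\<^sub>C f (t + s)) T - g t) \<le> \<epsilon>)" for K :: "real \<Rightarrow> complex"
  have cont: "continuous_on {0..} (\<lambda>s. K s *\<^sub>C f (t + s))" if "continuous_on {0..} K" "t \<in> I" for K t
    using that AP_continuous_shift[OF I f] by (intro scaleC.continuous_on)
  have PI: "P K" if "continuous_on {0..} K" "g \<in> trig_polynomials (- {0})"
    "\<And>\<epsilon>. \<epsilon> > 0 \<Longrightarrow> \<forall>\<^sub>F T in at_top. \<forall>t\<in>I. norm (average (\<lambda>s. K s *\<^sub>C f (t + s)) T - g t) \<le> \<epsilon>"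
    for K g
    unfolding P_def using that by (intro conjI bexI[of _ g] allI impI)
  have "P K"
    using K
  proof (induction K rule: trig_polynomials_induct)
    case zero
    show ?case
      unfolding P_def by (auto simp: scaleC.zero_left average_def intro!: bexI[OF _ trig_polynomials_zero])
  next
    case (add p q)
    then have c: "continuous_on {0..} p" "continuous_on {0..} q" by (auto simp: P_def)
    from add obtain g h where g: "g \<in> trig_polynomials (- {0})" "h \<in> trig_polynomials (- {0})"
      "\<And>\<epsilon>. \<epsilon> > 0 \<Longrightarrow> \<forall>\<^sub>F T in at_top. \<forall>t\<in>I. norm (average (\<lambda>s. p s *\<^sub>C f (t + s)) T - g t) \<le> \<epsilon>"
      "\<And>\<epsilon>. \<epsilon> > 0 \<Longrightarrow> \<forall>\<^sub>F T in at_top. \<forall>t\<in>I. norm (average (\<lambda>s. q s *\<^sub>C f (t + s)) T - h t) \<le> \<epsilon>"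
      unfolding P_def by blast
    have lim: "\<forall>\<^sub>F T in at_top. \<forall>t\<in>I.
        norm (average (\<lambda>s. (p s + q s) *\<^sub>C f (t + s)) T - (g t + h t)) \<le> \<epsilon>" if "\<epsilon> > 0" for \<epsilon>
    proof -
      have e: "\<epsilon> / 2 > 0" using that by simp
      show ?thesis
        using g(3)[OF e] g(4)[OF e]
      proof eventually_elim
        case (elim T)
        show ?case
        proof
          fix t assume t: "t \<in> I"
          have "average (\<lambda>s. (p s + q s) *\<^sub>C f (t + s)) T
              = average (\<lambda>s. p s *\<^sub>C f (t + s)) T + average (\<lambda>s. q s *\<^sub>C f (t + s)) T"
            unfolding scaleC.add_left by (intro average_add cont c t)
          then show "norm (average (\<lambda>s. (p s + q s) *\<^sub>C f (t + s)) T - (g t + h t)) \<le> \<epsilon>"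
            using elim[THEN bspec, OF t]
            by (smt (verit) add_diff_add norm_triangle_ineq field_sum_of_halves)
        qed
      qed
    qed
    show ?case
      by (rule PI[OF continuous_on_add[OF c] trig_polynomials_add[OF g(1,2)] lim])
  next
    case (scale a p)
    then have c: "continuous_on {0..} p" by (auto simp: P_def)
    from scale obtain g where g: "g \<in> trig_polynomials (- {0})"
      "\<And>\<epsilon>. \<epsilon> > 0 \<Longrightarrow> \<forall>\<^sub>F T in at_top. \<forall>t\<in>I. norm (average (\<lambda>s. p s *\<^sub>C f (t + s)) T - g t) \<le> \<epsilon>"
      unfolding P_def by blast
    have lim: "\<forall>\<^sub>F T in at_top. \<forall>t\<in>I.
        norm (average (\<lambda>s. (a *\<^sub>C p s) *\<^sub>C f (t + s)) T - a *\<^sub>C g t) \<le> \<epsilon>" if "\<epsilon> > 0" for \<epsilon>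
    proof -
      have a: "cmod a + 1 > 0" by (simp add: add_nonneg_pos)
      then have e: "\<epsilon> / (cmod a + 1) > 0" using that by simp
      show ?thesis
        using g(2)[OF e]
      proof eventually_elim
        case (elim T)
        show ?case
        proof
          fix t assume t: "t \<in> I"
          have "average (\<lambda>s. (a *\<^sub>C p s) *\<^sub>C f (t + s)) T = a *\<^sub>C average (\<lambda>s. p s *\<^sub>C f (t + s)) T"
            unfolding scaleC_complex_def scaleC_scaleC[symmetric]
            by (intro average_scaleC cont c t)
          then have "norm (average (\<lambda>s. (a *\<^sub>C p s) *\<^sub>C f (t + s)) T - a *\<^sub>C g t)
              = cmod a * norm (average (\<lambda>s. p s *\<^sub>C f (t + s)) T - g t)"
            by (simp add: norm_scaleC flip: scaleC.diff_right)
          also have "\<dots> \<le> (cmod a + 1) * (\<epsilon> / (cmod a + 1))"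
            using elim[THEN bspec, OF t] by (intro mult_mono) auto
          also have "\<dots> = \<epsilon>" using a by simp
          finally show "norm (average (\<lambda>s. (a *\<^sub>C p s) *\<^sub>C f (t + s)) T - a *\<^sub>C g t) \<le> \<epsilon>" .
        qed
      qed
    qed
    show ?case
      by (rule PI[OF scaleC.continuous_on[OF continuous_on_const c] trig_polynomials_scaleC[OF g(1)] lim])
  next
    case (base r a)
    define h where "h u = cis (r * u) *\<^sub>C f u" for u
    have h: "h \<in> AP I" unfolding h_def by (rule AP_cis[OF I f])
    obtain v where v: "\<And>\<epsilon>. \<epsilon> > 0 \<Longrightarrow>
        \<forall>\<^sub>F T in at_top. \<forall>t\<in>I. norm (average (\<lambda>s. h (t + s)) T - v) \<le> \<epsilon>"
      using AP_uniform_mean[OF I h] by blast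
    have v0: "v = 0" if "r = 0"
    proof (rule ccontr)
      assume "v \<noteq> 0"
      then have e: "norm v / 2 > 0" by simp
      have hf: "h = f" using that by (simp add: h_def fun_eq_iff scaleC_one)
      have "\<forall>\<^sub>F T in at_top. norm (average f T) < norm v / 2"
        using tendstoD[OF mean e] by simp
      then have "\<forall>\<^sub>F T :: real in at_top. False"
        using v[OF e]
      proof eventually_elim
        case (elim T)
        have "0 \<in> I" using I by auto
        then have "norm (average (\<lambda>s. f (0 + s)) T - v) \<le> norm v / 2" using elim(2) hf by blast
        then show False using elim(1) norm_triangle_sub[of v "average f T"]
          by (simp add: norm_minus_commute)
      qed
      then show False by simp
    qed
    define g where "g t = cis (- r * t) *\<^sub>C (a *\<^sub>C v)" for t
    have g: "g \<in> trig_polynomials (- {0})"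
    proof (cases "r = 0")
      case True
      then have "g = (\<lambda>_. 0)" using v0 by (simp add: g_def fun_eq_iff scaleC.zero_right)
      then show ?thesis by (simp add: trig_polynomials_zero)
    next
      case False
      then show ?thesis unfolding g_def by (intro trig_polynomials_base) auto
    qed
    have lim: "\<forall>\<^sub>F T in at_top. \<forall>t\<in>I.
        norm (average (\<lambda>s. (cis (r * s) *\<^sub>C a) *\<^sub>C f (t + s)) T - g t) \<le> \<epsilon>" if "\<epsilon> > 0" for \<epsilon>
    proof -
      have a: "cmod a + 1 > 0" by (simp add: add_nonneg_pos)
      then have e: "\<epsilon> / (cmod a + 1) > 0" using that by simp
      show ?thesis
        using v[OF e]
      proof eventually_elim
        case (elim T)
        show ?case
        proof
          fix t assume t: "t \<in> I"
          have "(cis (r * s) *\<^sub>C a) *\<^sub>C f (t + s) = (cis (- r * t) * a) *\<^sub>C h (t + s)" for s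
          proof -
            have "cis (r * s) * a = cis (- r * t) * a * cis (r * (t + s))"
              by (simp add: mult_ac cis_mult algebra_simps)
            then show ?thesis by (simp only: h_def scaleC_complex_def scaleC_scaleC)
          qed
          then have "average (\<lambda>s. (cis (r * s) *\<^sub>C a) *\<^sub>C f (t + s)) T
              = (cis (- r * t) * a) *\<^sub>C average (\<lambda>s. h (t + s)) T"
            using average_scaleC[OF AP_continuous_shift[OF I h t]] by simp
          moreover have "g t = (cis (- r * t) * a) *\<^sub>C v" by (simp add: g_def scaleC_scaleC)
          ultimately have "norm (average (\<lambda>s. (cis (r * s) *\<^sub>C a) *\<^sub>C f (t + s)) T - g t)
              = cmod a * norm (average (\<lambda>s. h (t + s)) T - v)"
            by (simp add: norm_scaleC norm_mult flip: scaleC.diff_right)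
          also have "\<dots> \<le> (cmod a + 1) * (\<epsilon> / (cmod a + 1))"
            using elim[THEN bspec, OF t] by (intro mult_mono) auto
          also have "\<dots> = \<epsilon>" using a by simp
          finally show "norm (average (\<lambda>s. (cis (r * s) *\<^sub>C a) *\<^sub>C f (t + s)) T - g t) \<le> \<epsilon>" .
        qed
      qed
    qed
    have "continuous_on {0..} (\<lambda>s. cis (r * s) *\<^sub>C a)"
      by (intro scaleC.continuous_on continuous_intros)
    then show ?case by (rule PI[OF _ g lim])
  qed
  then show ?thesis by (simp add: P_def)
qed

section \<open>Approximation by trigonometric polynomials\<close>

lemma integral_ge_of_windows:
  fixes K :: "real \<Rightarrow> real"
  assumes K: "continuous_on UNIV K" and w: "w \<ge> 0"
    and win: "\<And>a. a \<ge> 0 \<Longrightarrow> integral {a..a + w} K \<ge> \<beta>"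
  shows "integral {0..real m * w} K \<ge> real m * \<beta>"
proof (induction m)
  case (Suc m)
  have "integral {0..real m * w} K + integral {real m * w..real m * w + w} K
      = integral {0..real m * w + w} K"
    using w by (intro Henstock_Kurzweil_Integration.integral_combine
        integrable_continuous_interval continuous_on_subset[OF K]) auto
  then show ?case using Suc win[of "real m * w"] w by (simp add: algebra_simps)
qed simp

text \<open>
  The kernel is the mean of the functions \<open>(1 + cos (r * t)) / 2\<close>, each of which measures the distance
  of \<open>cis (r * t)\<close> from \<open>1\<close>. One bad frequency lowers the mean by at least \<open>\<delta>\<^sup>2 / (4 k)\<close>, while on a
  sufficiently small Bohr set it stays above the larger value \<open>1 - \<delta>\<^sup>2 / (8 k)\<close>. The gap between \<open>q\<close>
  and \<open>q'\<close> is what makes powers of the kernel concentrate on the Bohr set.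
\<close>

lemma bohr_kernel_bounds:
  fixes R :: "real set"
  assumes R: "finite R" "R \<noteq> {}" and \<delta>: "0 < \<delta>" "\<delta> \<le> 1"
  obtains p q q' \<rho> where
    "continuous_on UNIV p" "(\<lambda>t. complex_of_real (p t)) \<in> trig_polynomials UNIV"
    "\<And>t. 0 \<le> p t" "\<And>t. p t \<le> 1" "0 < q" "q < q'" "\<rho> > 0"
    "\<And>t. t \<notin> bohr_set R \<delta> \<Longrightarrow> p t \<le> q" "\<And>t. t \<in> bohr_set R \<rho> \<Longrightarrow> q' \<le> p t"
proof -
  define k where "k = real (card R)"
  have k: "k \<ge> 1" using R by (simp add: k_def Suc_le_eq card_gt_0_iff)
  define p where "p t = (\<Sum>r\<in>R. (1 + cos (r * t)) / 2) / k" for t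
  define \<rho> where "\<rho> = \<delta> / sqrt (2 * k)"
  have \<rho>: "\<rho> > 0" "\<rho>\<^sup>2 = \<delta>\<^sup>2 / (2 * k)" using \<delta> k by (auto simp: \<rho>_def power_divide)
  have summand: "(1 + cos (r * t)) / 2 = 1 - (cmod (cis (r * t) - 1))\<^sup>2 / 4" for r t
    by (simp add: norm_cis_minus_one_squared field_simps)
  have range: "0 \<le> (1 + cos (r * t)) / 2" "(1 + cos (r * t)) / 2 \<le> 1" for r t :: real
    using cos_ge_minus_one[of "r * t"] cos_le_one[of "r * t"] by (simp_all del: cos_ge_minus_one)
  show thesis
  proof (rule that[of p "1 - \<delta>\<^sup>2 / (4 * k)" "1 - \<delta>\<^sup>2 / (8 * k)" \<rho>])
    show "continuous_on UNIV p" unfolding p_def using k by (intro continuous_intros) auto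
    have "(\<lambda>t. \<Sum>r\<in>R. complex_of_real (1 / (2 * k)) *\<^sub>C
        (complex_of_real (cos (0 * t)) + complex_of_real (cos (r * t)))) \<in> trig_polynomials UNIV"
      by (intro trig_polynomials_sum R(1) trig_polynomials_scaleC trig_polynomials_add trig_polynomials_cos)
    moreover have "complex_of_real (p t) = (\<Sum>r\<in>R. complex_of_real (1 / (2 * k)) *\<^sub>C
        (complex_of_real (cos (0 * t)) + complex_of_real (cos (r * t))))" for t
      unfolding p_def sum_divide_distrib
      by (simp add: scaleC_complex_def)
    ultimately show "(\<lambda>t. complex_of_real (p t)) \<in> trig_polynomials UNIV" by simp
    show "0 \<le> p t" for t
      unfolding p_def using k range by (intro divide_nonneg_nonneg sum_nonneg) auto
    have "(\<Sum>r\<in>R. (1 + cos (r * t)) / 2) \<le> (\<Sum>r\<in>R. 1)" for t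
      by (intro sum_mono range)
    then show "p t \<le> 1" for t using k by (simp add: p_def k_def)
    have "\<delta>\<^sup>2 \<le> 1" using \<delta> by (simp add: power_le_one)
    then show "0 < 1 - \<delta>\<^sup>2 / (4 * k)" using k by (simp add: field_simps)
    show "1 - \<delta>\<^sup>2 / (4 * k) < 1 - \<delta>\<^sup>2 / (8 * k)" using \<delta> k by (simp add: field_simps)
    show "\<rho> > 0" by (rule \<rho>(1))
    fix t
    show "p t \<le> 1 - \<delta>\<^sup>2 / (4 * k)" if t: "t \<notin> bohr_set R \<delta>"
    proof -
      obtain r where r: "r \<in> R" "cmod (cis (r * t) - 1) \<ge> \<delta>"
        using t by (auto simp: bohr_set_def not_less)
      have "\<delta>\<^sup>2 \<le> (cmod (cis (r * t) - 1))\<^sup>2" using r \<delta> by (intro power_mono) auto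
      then have le: "(1 + cos (r * t)) / 2 \<le> 1 - \<delta>\<^sup>2 / 4" unfolding summand by simp
      have "(\<Sum>r\<in>R. (1 + cos (r * t)) / 2)
          = (1 + cos (r * t)) / 2 + (\<Sum>r\<in>R - {r}. (1 + cos (r * t)) / 2)"
        using R r by (simp add: sum.remove)
      also have "(\<Sum>r\<in>R - {r}. (1 + cos (r * t)) / 2) \<le> (\<Sum>r\<in>R - {r}. 1)"
        by (intro sum_mono range)
      also have "(\<Sum>r\<in>R - {r}. 1) = k - 1"
        using R r k by (simp add: k_def card_Diff_singleton of_nat_diff)
      finally have "(\<Sum>r\<in>R. (1 + cos (r * t)) / 2) \<le> k - \<delta>\<^sup>2 / 4" using le by linarith
      then have "p t \<le> (k - \<delta>\<^sup>2 / 4) / k"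
        unfolding p_def using k by (intro divide_right_mono) auto
      then show ?thesis using k by (simp add: diff_divide_distrib)
    qed
    show "1 - \<delta>\<^sup>2 / (8 * k) \<le> p t" if "t \<in> bohr_set R \<rho>"
    proof -
      have "1 - \<rho>\<^sup>2 / 4 \<le> (1 + cos (r * t)) / 2" if "r \<in> R" for r
      proof -
        have "cmod (cis (r * t) - 1) \<le> \<rho>"
          using \<open>t \<in> bohr_set R \<rho>\<close> that by (auto simp: bohr_set_def)
        then have "(cmod (cis (r * t) - 1))\<^sup>2 \<le> \<rho>\<^sup>2" by (intro power_mono) auto
        then show ?thesis unfolding summand by simp
      qed
      then have "(\<Sum>r\<in>R. 1 - \<rho>\<^sup>2 / 4) \<le> (\<Sum>r\<in>R. (1 + cos (r * t)) / 2)" by (intro sum_mono)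
      then have "k * (1 - \<rho>\<^sup>2 / 4) / k \<le> p t"
        unfolding p_def using k by (intro divide_right_mono) (auto simp: k_def)
      moreover have "\<rho>\<^sup>2 / 4 = \<delta>\<^sup>2 / (8 * k)" by (simp add: \<rho>(2))
      ultimately show ?thesis using k by simp
    qed
  qed
qed

text \<open>
  A high power of the kernel serves as approximate identity. On a Bohr set whose elements
  are translation numbers of \<open>f\<close> its weight is harmless; off that set it is at most \<open>q ^ n\<close>. Its average is at
  least a positive constant times \<open>q' ^ n\<close>, since a smaller Bohr set meets every window of
  length \<open>w\<close> in an interval of length \<open>\<eta>\<close>, and \<open>q ^ n / q' ^ n\<close> tends to zero.
  The lower bound \<open>\<kappa>\<close> is the same for arbitrarily large \<open>T\<close>, so that limits of averages can be
  taken before dividing by the average of the kernel.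
\<close>

lemma AP_approximate_identity:
  fixes f :: "real \<Rightarrow> 'e :: complex_banach"
  assumes I: "I = UNIV \<or> I = {0..}" and f: "f \<in> AP I" and \<epsilon>: "\<epsilon> > 0"
  obtains K \<kappa> where "(\<lambda>s. complex_of_real (K s)) \<in> trig_polynomials UNIV" "\<kappa> > 0"
    "\<forall>T0. \<exists>T\<ge>T0. \<kappa> \<le> average K T \<and>
      (\<forall>t\<in>I. norm (average (\<lambda>s. complex_of_real (K s) *\<^sub>C f (t + s)) T - average K T *\<^sub>R f t)
        \<le> \<epsilon> * average K T)"
proof -
  have f': "c_almost_periodic 1 I f" using f by (simp add: AP_def)
  obtain B where B: "B > 0" "\<And>t. t \<in> I \<Longrightarrow> norm (f t) \<le> B"
    using c_ap_bounded[OF I norm_one f'] by blast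
  have "\<epsilon> / 2 > 0" using \<epsilon> by simp
  from bohr_uniformE[OF AP_imp_bohr_uniform[OF I f] this] obtain R0 \<delta>0 where R0: "finite R0" "\<delta>0 > 0"
    "\<And>\<tau> t. \<tau> \<ge> 0 \<Longrightarrow> \<tau> \<in> bohr_set R0 \<delta>0 \<Longrightarrow> t \<in> I \<Longrightarrow> norm (f (t + \<tau>) - f t) \<le> \<epsilon> / 2"
    by blast
  \<comment> \<open>The frequency zero imposes no condition; adding it makes the set of frequencies non-empty.\<close>
  define R where "R = insert 0 R0"
  define \<delta> where "\<delta> = min \<delta>0 1"
  have R: "finite R" "R \<noteq> {}" "0 < \<delta>" "\<delta> \<le> 1" using R0 by (auto simp: R_def \<delta>_def)
  have near: "norm (f (t + \<tau>) - f t) \<le> \<epsilon> / 2" if "\<tau> \<ge> 0" "\<tau> \<in> bohr_set R \<delta>" "t \<in> I" for \<tau> t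
  proof -
    have "\<tau> \<in> bohr_set R0 \<delta>0" using that(2) by (auto simp: bohr_set_def R_def \<delta>_def)
    then show ?thesis using R0(3) that by blast
  qed
  obtain p q q' \<rho> where p: "continuous_on UNIV p"
      "(\<lambda>t. complex_of_real (p t)) \<in> trig_polynomials UNIV"
      "\<And>t. 0 \<le> p t" "\<And>t. p t \<le> 1" and q: "0 < q" "q < q'" and \<rho>: "\<rho> > 0"
    and off: "\<And>t. t \<notin> bohr_set R \<delta> \<Longrightarrow> p t \<le> q" and on: "\<And>t. t \<in> bohr_set R \<rho> \<Longrightarrow> q' \<le> p t"
    using bohr_kernel_bounds[OF R] by metis
  have "relatively_dense {t. t > 0 \<and> t \<in> bohr_set R (\<rho> / 2)}"
    using \<rho> by (intro bohr_set_relatively_dense R(1)) simp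
  then obtain l where l: "l > 0"
    "\<And>a. a \<ge> 0 \<Longrightarrow> {a..a + l} \<inter> {t. t > 0 \<and> t \<in> bohr_set R (\<rho> / 2)} \<noteq> {}"
    unfolding relatively_dense_def by (elim exE conjE) blast
  obtain b where b: "b > 0" "\<And>r. r \<in> R \<Longrightarrow> \<bar>r\<bar> \<le> b"
    using finite_imp_bounded[OF R(1)] unfolding bounded_pos real_norm_def by blast
  define \<eta> where "\<eta> = \<rho> / (2 * b)"
  have \<eta>: "\<eta> > 0" using \<rho> b by (simp add: \<eta>_def)
  define w where "w = l + \<eta>"
  have w: "w > 0" using l \<eta> by (simp add: w_def)
  define d where "d = \<epsilon> / 2 * (\<eta> / w) / (2 * B)"
  have d: "d > 0" using \<epsilon> \<eta> w B by (simp add: d_def)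
  have "q / q' < 1" using q by simp
  then obtain n where "(q / q') ^ n < d" using real_arch_pow_inv[OF d] by blast
  then have n: "q ^ n \<le> d * q' ^ n"
    using q by (simp add: power_divide divide_less_eq split: if_splits)
  define K where "K s = p s ^ n" for s
  have K: "continuous_on UNIV K" "\<And>s. K s \<ge> 0"
    unfolding K_def using p by (auto intro!: continuous_intros)
  have contK: "continuous_on S K" for S
    using K(1) by (rule continuous_on_subset) simp
  define \<kappa> where "\<kappa> = \<eta> * q' ^ n / w"
  have \<kappa>: "\<kappa> > 0" using \<eta> w q by (simp add: \<kappa>_def)
  have tail: "2 * B * q ^ n \<le> \<epsilon> / 2 * \<kappa>"
  proof -
    have "2 * B * q ^ n \<le> 2 * B * (d * q' ^ n)" using n B by (intro mult_left_mono) auto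
    also have "\<dots> = \<epsilon> / 2 * \<kappa>" using B by (simp add: d_def \<kappa>_def)
    finally show ?thesis .
  qed

  have window: "integral {a..a + w} K \<ge> \<eta> * q' ^ n" if a: "a \<ge> 0" for a
  proof -
    obtain \<tau> where \<tau>: "\<tau> \<in> {a..a + l}" "\<tau> \<in> bohr_set R (\<rho> / 2)" using l(2)[OF a] by blast
    have "K s \<ge> q' ^ n" if s: "s \<in> {\<tau>..\<tau> + \<eta>}" for s
    proof -
      have "s \<in> bohr_set R \<rho>"
        unfolding bohr_set_def
      proof (intro CollectI ballI)
        fix r assume r: "r \<in> R"
        have "cmod (cis (r * (s - \<tau>)) - 1) \<le> \<bar>r\<bar> * \<bar>s - \<tau>\<bar>"
          using norm_cis_minus_one_le[of "r * (s - \<tau>)"] by (simp add: abs_mult)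
        also have "\<dots> \<le> b * \<eta>" using b r s by (intro mult_mono) auto
        also have "\<dots> = \<rho> / 2" using b by (simp add: \<eta>_def)
        finally have "cmod (cis (r * (s - \<tau>)) - 1) \<le> \<rho> / 2" .
        moreover have "cmod (cis (r * \<tau>) - 1) < \<rho> / 2" using \<tau>(2) r by (auto simp: bohr_set_def)
        moreover have "r * s = r * \<tau> + r * (s - \<tau>)" by (simp add: algebra_simps)
        ultimately show "cmod (cis (r * s) - 1) < \<rho>"
          using norm_cis_add_minus_one_le[of "r * \<tau>" "r * (s - \<tau>)"] by simp
      qed
      then show ?thesis unfolding K_def using on q by (intro power_mono) auto
    qed
    then have "integral {\<tau>..\<tau> + \<eta>} (\<lambda>_. q' ^ n) \<le> integral {\<tau>..\<tau> + \<eta>} K"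
      by (intro integral_le integrable_continuous_interval contK) auto
    also have "integral {\<tau>..\<tau> + \<eta>} (\<lambda>_. q' ^ n) = \<eta> * q' ^ n" using \<eta> by simp
    also have "integral {\<tau>..\<tau> + \<eta>} K \<le> integral {a..a + w} K"
      using \<tau>(1) \<eta> K(2) by (intro integral_subset_le integrable_continuous_interval contK) (auto simp: w_def)
    finally show ?thesis .
  qed

  have good: "\<kappa> \<le> average K T \<and>
      (\<forall>t\<in>I. norm (average (\<lambda>s. complex_of_real (K s) *\<^sub>C f (t + s)) T - average K T *\<^sub>R f t)
        \<le> \<epsilon> * average K T)" if m: "m > 0" and T: "T = real m * w" for m T
  proof
    have Tpos: "T > 0" using m w T by simp
    have "real m * (\<eta> * q' ^ n) \<le> integral {0..T} K"
      unfolding T using w by (intro integral_ge_of_windows[OF K(1)] window) auto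
    then have "real m * (\<eta> * q' ^ n) / T \<le> average K T"
      using Tpos by (simp add: average_def divide_right_mono)
    then show *: "\<kappa> \<le> average K T" using m by (simp add: T \<kappa>_def)
    show "\<forall>t\<in>I. norm (average (\<lambda>s. complex_of_real (K s) *\<^sub>C f (t + s)) T - average K T *\<^sub>R f t)
        \<le> \<epsilon> * average K T"
    proof
      fix t assume t: "t \<in> I"
      have cf: "continuous_on {0..T} (\<lambda>s. f (t + s))"
        by (rule continuous_on_subset[OF AP_continuous_shift[OF I f t]]) auto
      have i1: "(\<lambda>s. K s *\<^sub>R f (t + s)) integrable_on {0..T}" "(\<lambda>s. K s *\<^sub>R f t) integrable_on {0..T}"
        and i2: "K integrable_on {0..T}"
        by (intro integrable_continuous_interval continuous_intros contK cf)+
      have "norm (integral {0..T} (\<lambda>s. K s *\<^sub>R f (t + s) - K s *\<^sub>R f t))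
          \<le> integral {0..T} (\<lambda>s. \<epsilon> / 2 * K s + 2 * B * q ^ n)"
      proof (rule integral_norm_bound_integral)
        show "(\<lambda>s. K s *\<^sub>R f (t + s) - K s *\<^sub>R f t) integrable_on {0..T}"
          using i1 by (rule integrable_diff)
        show "(\<lambda>s. \<epsilon> / 2 * K s + 2 * B * q ^ n) integrable_on {0..T}"
          by (intro integrable_continuous_interval continuous_intros contK)
        fix s assume s: "s \<in> {0..T}"
        have eq: "norm (K s *\<^sub>R f (t + s) - K s *\<^sub>R f t) = K s * norm (f (t + s) - f t)"
          using K(2) by (simp flip: scaleR_diff_right)
        show "norm (K s *\<^sub>R f (t + s) - K s *\<^sub>R f t) \<le> \<epsilon> / 2 * K s + 2 * B * q ^ n"
        proof (cases "s \<in> bohr_set R \<delta>")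
          case True
          then have "norm (f (t + s) - f t) \<le> \<epsilon> / 2" using near s t by auto
          then have "K s * norm (f (t + s) - f t) \<le> K s * (\<epsilon> / 2)"
            using K(2) by (intro mult_left_mono)
          also have "\<dots> = \<epsilon> / 2 * K s" by simp
          also have "\<dots> \<le> \<epsilon> / 2 * K s + 2 * B * q ^ n" using B q by simp
          finally show ?thesis unfolding eq .
        next
          case False
          have "norm (f (t + s)) \<le> B" "norm (f t) \<le> B"
            using B t s half_line_add_closed[OF I t, of s] by auto
          then have "norm (f (t + s) - f t) \<le> 2 * B"
            using norm_triangle_ineq4[of "f (t + s)" "f t"] by linarith
          moreover have "K s \<le> q ^ n" unfolding K_def using off[OF False] p(3) by (intro power_mono)
          ultimately have "K s * norm (f (t + s) - f t) \<le> q ^ n * (2 * B)"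
            using q by (intro mult_mono) auto
          moreover have "\<epsilon> / 2 * K s \<ge> 0" using \<epsilon> K(2) by simp
          ultimately show ?thesis unfolding eq by (simp add: mult.commute)
        qed
      qed
      also have "\<dots> = \<epsilon> / 2 * integral {0..T} K + 2 * B * q ^ n * T"
      proof -
        have "(\<lambda>s. \<epsilon> / 2 * K s) integrable_on {0..T}"
          by (intro integrable_continuous_interval continuous_intros contK)
        then have "integral {0..T} (\<lambda>s. \<epsilon> / 2 * K s + 2 * B * q ^ n)
            = integral {0..T} (\<lambda>s. \<epsilon> / 2 * K s) + integral {0..T} (\<lambda>_. 2 * B * q ^ n)"
          by (intro integral_add integrable_const_ivl)
        then show ?thesis using Tpos by simp
      qed
      finally have "norm (integral {0..T} (\<lambda>s. K s *\<^sub>R f (t + s) - K s *\<^sub>R f t)) / T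
          \<le> (\<epsilon> / 2 * integral {0..T} K + 2 * B * q ^ n * T) / T"
        using Tpos by (intro divide_right_mono) auto
      also have "\<dots> = \<epsilon> / 2 * average K T + 2 * B * q ^ n"
        using Tpos by (simp add: average_def field_simps)
      also have "\<dots> \<le> \<epsilon> / 2 * average K T + \<epsilon> / 2 * average K T"
      proof -
        have "\<epsilon> / 2 * \<kappa> \<le> \<epsilon> / 2 * average K T" using * \<epsilon> by (intro mult_left_mono) auto
        then show ?thesis using tail by linarith
      qed
      finally have "norm (integral {0..T} (\<lambda>s. K s *\<^sub>R f (t + s) - K s *\<^sub>R f t)) / T
          \<le> \<epsilon> * average K T" by simp
      moreover have "average (\<lambda>s. complex_of_real (K s) *\<^sub>C f (t + s)) T - average K T *\<^sub>R f t
          = (1 / T) *\<^sub>R integral {0..T} (\<lambda>s. K s *\<^sub>R f (t + s) - K s *\<^sub>R f t)"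
      proof -
        have "integral {0..T} (\<lambda>s. K s *\<^sub>R f t) = integral {0..T} K *\<^sub>R f t"
          using integral_linear[OF i2 bounded_linear_scaleR_left, of "f t"] by (simp add: o_def)
        then show ?thesis
          using i1 by (simp add: average_def scaleC_of_real integral_diff scaleR_diff_right)
      qed
      ultimately show "norm (average (\<lambda>s. complex_of_real (K s) *\<^sub>C f (t + s)) T - average K T *\<^sub>R f t)
          \<le> \<epsilon> * average K T" using Tpos by simp
    qed
  qed
  show thesis
  proof (rule that[OF _ \<kappa>])
    show "(\<lambda>s. complex_of_real (K s)) \<in> trig_polynomials UNIV"
      using trig_polynomials_power[OF p(2), of n] by (simp add: K_def)
  next
    show "\<forall>T0. \<exists>T\<ge>T0. \<kappa> \<le> average K T \<and>
      (\<forall>t\<in>I. norm (average (\<lambda>s. complex_of_real (K s) *\<^sub>C f (t + s)) T - average K T *\<^sub>R f t)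
        \<le> \<epsilon> * average K T)"
    proof
    fix T0
    obtain m where "T0 / w < real m" using reals_Archimedean2 by blast
    then have "T0 \<le> real (Suc m) * w" using w by (simp add: field_simps)
    then show "\<exists>T\<ge>T0. \<kappa> \<le> average K T \<and>
      (\<forall>t\<in>I. norm (average (\<lambda>s. complex_of_real (K s) *\<^sub>C f (t + s)) T - average K T *\<^sub>R f t)
        \<le> \<epsilon> * average K T)"
      using good[of "Suc m" "real (Suc m) * w"] by blast
    qed
  qed
qed

text \<open>
  Bohr's approximation theorem for functions of mean value zero: convolution with the approximate
  identity stays close to \<open>f\<close> and is close to a trigonometric polynomial. The kernel is normalised
  by its average over the same window \<open>{0..T}\<close>, which is at least \<open>\<kappa>\<close>.
\<close>

theorem AP_approximation:
  fixes f :: "real \<Rightarrow> 'e :: complex_banach"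
  assumes I: "I = UNIV \<or> I = {0..}" and f: "f \<in> AP I" and mean: "(average f \<longlongrightarrow> 0) at_top"
    and \<epsilon>: "\<epsilon> > 0"
  shows "\<exists>g\<in>trig_polynomials (- {0}). \<forall>t\<in>I. norm (f t - g t) \<le> \<epsilon>"
proof -
  have e2: "\<epsilon> / 2 > 0" using \<epsilon> by simp
  obtain K \<kappa> where K: "(\<lambda>s. complex_of_real (K s)) \<in> trig_polynomials UNIV" "\<kappa> > 0"
    "\<forall>T0. \<exists>T\<ge>T0. \<kappa> \<le> average K T \<and>
      (\<forall>t\<in>I. norm (average (\<lambda>s. complex_of_real (K s) *\<^sub>C f (t + s)) T - average K T *\<^sub>R f t)
        \<le> \<epsilon> / 2 * average K T)"
    by (rule AP_approximate_identity[OF I f e2])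
  obtain h where h: "h \<in> trig_polynomials (- {0})" "\<forall>\<epsilon>>0. \<forall>\<^sub>F T in at_top. \<forall>t\<in>I.
      norm (average (\<lambda>s. complex_of_real (K s) *\<^sub>C f (t + s)) T - h t) \<le> \<epsilon>"
    using AP_convolution_trig_polynomial[OF I f mean K(1)] by (elim bexE)
  have "\<epsilon> / 2 * \<kappa> > 0" using e2 K(2) by simp
  then obtain T0 where T0: "\<forall>T\<ge>T0. \<forall>t\<in>I.
      norm (average (\<lambda>s. complex_of_real (K s) *\<^sub>C f (t + s)) T - h t) \<le> \<epsilon> / 2 * \<kappa>"
    using h(2)[rule_format, of "\<epsilon> / 2 * \<kappa>"] unfolding eventually_at_top_linorder by blast
  obtain T where T: "T \<ge> T0" "\<kappa> \<le> average K T"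
    "\<forall>t\<in>I. norm (average (\<lambda>s. complex_of_real (K s) *\<^sub>C f (t + s)) T - average K T *\<^sub>R f t)
      \<le> \<epsilon> / 2 * average K T"
    using spec[OF K(3), of T0] by (elim exE conjE)
  define M where "M = average K T"
  have M: "M > 0" "\<kappa> \<le> M" using T(2) K(2) by (auto simp: M_def)
  define g where "g t = complex_of_real (1 / M) *\<^sub>C h t" for t
  have "g \<in> trig_polynomials (- {0})" unfolding g_def by (rule trig_polynomials_scaleC[OF h(1)])
  moreover have "norm (f t - g t) \<le> \<epsilon>" if t: "t \<in> I" for t
  proof -
    have "norm (h t - M *\<^sub>R f t) \<le> \<epsilon> / 2 * \<kappa> + \<epsilon> / 2 * M"
    proof (rule norm_diff_triangle_le)
      show "norm (h t - average (\<lambda>s. complex_of_real (K s) *\<^sub>C f (t + s)) T) \<le> \<epsilon> / 2 * \<kappa>"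
        using T0 T(1) t by (simp add: norm_minus_commute)
      show "norm (average (\<lambda>s. complex_of_real (K s) *\<^sub>C f (t + s)) T - M *\<^sub>R f t) \<le> \<epsilon> / 2 * M"
        using T(3) t by (simp add: M_def)
    qed
    also have "\<epsilon> / 2 * \<kappa> \<le> \<epsilon> / 2 * M" using M \<epsilon> by simp
    finally have "norm (M *\<^sub>R f t - h t) \<le> \<epsilon> * M" by (simp add: norm_minus_commute mult.commute)
    moreover have "f t - g t = (1 / M) *\<^sub>R (M *\<^sub>R f t - h t)"
      unfolding g_def scaleC_of_real using M by (simp add: scaleR_diff_right)
    ultimately show ?thesis using M by (simp add: divide_le_eq)
  qed
  ultimately show ?thesis by blast
qed

section \<open>The closed span of the c-almost periodic functions\<close>

text \<open>
  The shifts \<open>\<tau>\<close> with \<open>cis (r * \<tau>) = c\<close> form an arithmetic progression of step \<open>2 pi / \<bar>r\<bar>\<close>, and the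
  exponential satisfies \<open>f (t + \<tau>) = c f t\<close> exactly for them.
\<close>

lemma cis_c_almost_periodic:
  fixes v :: "'e :: complex_banach"
  assumes I: "I = UNIV \<or> I = {0..}" and c: "cmod c = 1" and r: "r \<noteq> 0"
  shows "c_almost_periodic c I (\<lambda>t. if t \<in> I then cis (r * t) *\<^sub>C v else 0)"
proof -
  define f where "f t = (if t \<in> I then cis (r * t) *\<^sub>C v else 0)" for t
  have "continuous_on I (\<lambda>t. cis (r * t) *\<^sub>C v)"
    by (intro scaleC.continuous_on continuous_intros)
  then have cont: "continuous_on I f"
    by (rule continuous_on_eq) (simp add: f_def)
  have "c = rcis 1 (Arg c)" using rcis_cmod_Arg[of c] c by simp
  then have carg: "c = cis (Arg c)" by (simp add: rcis_def)
  define P where "P = 2 * pi / \<bar>r\<bar>"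
  have P: "P > 0" using r by (simp add: P_def)
  have period: "cis (Arg c + r * (of_int k * P)) = c" for k :: int
  proof -
    define j where "j = (if r > 0 then k else - k)"
    have "r * (of_int k * P) = 2 * pi * of_int j" using r by (auto simp: P_def j_def field_simps)
    moreover have "cis (2 * pi * of_int j) = 1" by (rule cis_multiple_2pi) simp
    ultimately show ?thesis using carg by (simp flip: cis_mult)
  qed
  have "relatively_dense {\<tau>. \<tau> > 0 \<and> (\<forall>t\<in>I. norm (f (t + \<tau>) - c *\<^sub>C f t) \<le> \<epsilon>)}"
    if \<epsilon>: "\<epsilon> > 0" for \<epsilon>
    unfolding relatively_dense_def
  proof (intro exI[of _ "1 + P"] conjI allI impI)
    fix a :: real assume a: "a \<ge> 0"
    define k where "k = \<lceil>(a + 1 - Arg c / r) / P\<rceil>"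
    define \<tau> where "\<tau> = Arg c / r + of_int k * P"
    have "(a + 1 - Arg c / r) / P \<le> of_int k" "of_int k < (a + 1 - Arg c / r) / P + 1"
      unfolding k_def by linarith+
    then have \<tau>: "a + 1 \<le> \<tau>" "\<tau> \<le> a + 1 + P"
      using P by (simp_all add: \<tau>_def field_simps)
    have "r * \<tau> = Arg c + r * (of_int k * P)" using r by (simp add: \<tau>_def distrib_left)
    then have cis: "cis (r * \<tau>) = c" using period by simp
    have "f (t + \<tau>) = c *\<^sub>C f t" if "t \<in> I" for t
      using that half_line_add_closed[OF I that, of \<tau>] \<tau> a
      by (simp add: f_def distrib_left scaleC_scaleC mult.commute flip: cis_mult cis)
    then have "\<tau> \<in> {a..a + (1 + P)} \<inter> {\<tau>. \<tau> > 0 \<and> (\<forall>t\<in>I. norm (f (t + \<tau>) - c *\<^sub>C f t) \<le> \<epsilon>)}"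
      using \<tau> a \<epsilon> by auto
    then show "{a..a + (1 + P)} \<inter> {\<tau>. \<tau> > 0 \<and> (\<forall>t\<in>I. norm (f (t + \<tau>) - c *\<^sub>C f t) \<le> \<epsilon>)} \<noteq> {}"
      by blast
  qed (use P in simp)
  then show ?thesis
    using cont by (simp add: c_almost_periodic_def f_def[abs_def])
qed

lemma cis_AP:
  fixes v :: "'e :: complex_banach"
  assumes I: "I = UNIV \<or> I = {0..}"
  shows "(\<lambda>t. if t \<in> I then cis (r * t) *\<^sub>C v else 0) \<in> AP I"
proof -
  define f where "f t = (if t \<in> I then v else 0)" for t
  have "continuous_on I f"
    by (rule continuous_on_eq[OF continuous_on_const[of I v]]) (simp add: f_def)
  moreover have "bohr_uniform I f"
    unfolding bohr_uniform_def
    using half_line_add_closed[OF I] by (auto simp: f_def intro!: exI[of _ "{}"] exI[of _ "1 :: real"])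
  ultimately have "f \<in> AP I" unfolding AP_iff_bohr_uniform[OF I] by (simp add: f_def)
  from AP_cis[OF I this, of r] show ?thesis
    by (simp add: f_def if_distrib[of "scaleC _"] scaleC.zero_right cong: if_cong)
qed

text \<open>
  Functions on \<open>I\<close> are represented by their extension by zero, so trigonometric polynomials have to be
  cut off outside \<open>I\<close> before they can be compared with elements of \<open>AP I\<close>. The cut-off is linear,
  so membership in a subspace \<open>V\<close> needs to be known for exponentials only.
\<close>

lemma trig_polynomials_restrict:
  fixes g :: "real \<Rightarrow> 'e :: complex_banach"
  assumes V: "cfun.subspace V"
    and base: "\<And>r v. r \<in> \<Lambda> \<Longrightarrow> (\<lambda>t. if t \<in> I then cis (r * t) *\<^sub>C v else 0) \<in> V"
    and g: "g \<in> trig_polynomials \<Lambda>"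
  shows "(\<lambda>t. if t \<in> I then g t else 0) \<in> V"
  using g
proof (induction g rule: trig_polynomials_induct)
  case zero
  show ?case using cfun.subspace_0[OF V] by (simp add: zero_fun_def)
next
  case (add p q)
  have "(\<lambda>t. if t \<in> I then p t + q t else 0)
      = (\<lambda>t. if t \<in> I then p t else 0) + (\<lambda>t. if t \<in> I then q t else 0)"
    by (auto simp: fun_eq_iff)
  then show ?case using cfun.subspace_add[OF V add] by simp
next
  case (scale a p)
  have "(\<lambda>t. if t \<in> I then a *\<^sub>C p t else 0) = (\<lambda>t. a *\<^sub>C (if t \<in> I then p t else 0))"
    by (auto simp: fun_eq_iff scaleC.zero_right)
  then show ?case using cfun.subspace_scale[OF V scale] by simp
next
  case (base r v)
  then show ?case by (rule assms(2))
qed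

lemma norm_le_AP_dist:
  fixes f g :: "real \<Rightarrow> 'e :: complex_banach"
  assumes I: "I = UNIV \<or> I = {0..}" and f: "f \<in> AP I" and g: "g \<in> AP I" and t: "t \<in> I"
  shows "norm (f t - g t) \<le> AP_dist I f g"
proof -
  obtain B C where B: "\<forall>t\<in>I. norm (f t) \<le> B" and C: "\<forall>t\<in>I. norm (g t) \<le> C"
    using AP_bounded[OF I f] AP_bounded[OF I g] by (elim exE)
  have "norm (f t - g t) \<le> B + C" if "t \<in> I" for t
    using that B C by (intro order_trans[OF norm_triangle_ineq4 add_mono]) auto
  then have "bdd_above ((\<lambda>t. norm (f t - g t)) ` I)" by (auto simp: bdd_above_def)
  from cSUP_upper[OF t this] show ?thesis using f g by (simp add: AP_dist_def)
qed

lemma closed_AP_c0_iff: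
  fixes f :: "real \<Rightarrow> 'e :: complex_banach"
  assumes I: "I = UNIV \<or> I = {0..}"
  shows "f \<in> closed_AP_c0 c I \<longleftrightarrow>
    f \<in> AP I \<and> (\<forall>\<epsilon>>0. \<exists>g\<in>AP_c0 c I \<inter> AP I. \<forall>t\<in>I. norm (f t - g t) \<le> \<epsilon>)"
proof -
  interpret Metric_space "AP I :: (real \<Rightarrow> 'e) set" "AP_dist I"
    by (rule Metric_space_AP[OF I])
  have I0: "I \<noteq> {}" using I by auto
  have closure: "f \<in> closed_AP_c0 c I \<longleftrightarrow>
      f \<in> AP I \<and> (\<forall>\<epsilon>>0. \<exists>g\<in>AP_c0 c I. f \<in> AP I \<and> g \<in> AP I \<and> AP_dist I f g < \<epsilon>)"
    unfolding closed_AP_c0_def metric_closure_of by (simp add: in_mball)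
  show ?thesis
    unfolding closure
  proof (intro conj_cong refl iffI allI impI)
    fix \<epsilon> :: real assume f: "f \<in> AP I" and \<epsilon>: "\<epsilon> > 0"
    assume "\<forall>\<epsilon>>0. \<exists>g\<in>AP_c0 c I. f \<in> AP I \<and> g \<in> AP I \<and> AP_dist I f g < \<epsilon>"
    then obtain g where g: "g \<in> AP_c0 c I" "g \<in> AP I" "AP_dist I f g < \<epsilon>" using \<epsilon> by blast
    have "norm (f t - g t) \<le> \<epsilon>" if "t \<in> I" for t
      using norm_le_AP_dist[OF I f g(2) that] g(3) by simp
    then show "\<exists>g\<in>AP_c0 c I \<inter> AP I. \<forall>t\<in>I. norm (f t - g t) \<le> \<epsilon>" using g by blast
  next
    fix \<epsilon> :: real assume f: "f \<in> AP I" and \<epsilon>: "\<epsilon> > 0"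
    assume approx: "\<forall>\<epsilon>>0. \<exists>g\<in>AP_c0 c I \<inter> AP I. \<forall>t\<in>I. norm (f t - g t) \<le> \<epsilon>"
    have "\<epsilon> / 2 > 0" using \<epsilon> by simp
    then obtain g where g: "g \<in> AP_c0 c I" "g \<in> AP I" "\<forall>t\<in>I. norm (f t - g t) \<le> \<epsilon> / 2"
      using approx by blast
    have "(SUP t\<in>I. norm (f t - g t)) \<le> \<epsilon> / 2" using I0 g(3) by (intro cSUP_least) auto
    then have "AP_dist I f g < \<epsilon>" using f g(2) \<epsilon> by (simp add: AP_dist_def)
    then show "\<exists>g\<in>AP_c0 c I. f \<in> AP I \<and> g \<in> AP I \<and> AP_dist I f g < \<epsilon>" using f g by blast
  qed
qed

lemma AP_spec_nonzero_iff:
  fixes f :: "real \<Rightarrow> 'e :: complex_banach"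
  assumes I: "I = UNIV \<or> I = {0..}"
  shows "f \<in> AP_spec (UNIV - {0}) I \<longleftrightarrow> f \<in> AP I \<and> (average f \<longlongrightarrow> 0) at_top"
proof -
  have "bohr_coeff 0 f = 0 \<longleftrightarrow> (average f \<longlongrightarrow> 0) at_top" if f: "f \<in> AP I"
  proof -
    obtain v where v: "(average f \<longlongrightarrow> v) at_top" using AP_average_convergent[OF I f] by (elim exE)
    then have "bohr_coeff 0 f = v" by (simp add: bohr_coeff_0 tendsto_Lim)
    moreover have "v = 0" if "(average f \<longlongrightarrow> 0) at_top"
      by (rule tendsto_unique[OF trivial_limit_at_top_linorder v that])
    ultimately show ?thesis using v by metis
  qed
  then show ?thesis by (auto simp: AP_spec_def bohr_spectrum_def)
qed

lemma AP_c0_average_tendsto_0: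
  fixes f :: "real \<Rightarrow> 'e :: complex_banach"
  assumes I: "I = UNIV \<or> I = {0..}" and c: "cmod c = 1" "c \<noteq> 1" and f: "f \<in> AP_c0 c I"
  shows "continuous_on {0..} f \<and> (average f \<longlongrightarrow> 0) at_top"
  using f unfolding AP_c0_def
proof (rule cfun.span_induct)
  show "cfun.subspace {f :: real \<Rightarrow> 'e. continuous_on {0..} f \<and> (average f \<longlongrightarrow> 0) at_top}"
  proof (rule cfun.subspaceI; clarify; (intro CollectI conjI)?)
    show "continuous_on {0..} (0 :: real \<Rightarrow> 'e)" unfolding zero_fun_def by (rule continuous_on_const)
    show "(average (0 :: real \<Rightarrow> 'e) \<longlongrightarrow> 0) at_top"
      unfolding zero_fun_def average_def by simp
    fix f g :: "real \<Rightarrow> 'e" and a :: complex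
    assume f: "continuous_on {0..} f" "(average f \<longlongrightarrow> 0) at_top"
    show "continuous_on {0..} (\<lambda>t. a *\<^sub>C f t)" using f by (intro scaleC.continuous_on continuous_on_const)
    have "average (\<lambda>t. a *\<^sub>C f t) = (\<lambda>T. a *\<^sub>C average f T)"
      using f(1) by (intro ext average_scaleC)
    then show "(average (\<lambda>t. a *\<^sub>C f t) \<longlongrightarrow> 0) at_top"
      using scaleC.tendsto[OF tendsto_const f(2), of a] by (simp add: scaleC.zero_right)
    assume g: "continuous_on {0..} g" "(average g \<longlongrightarrow> 0) at_top"
    show "continuous_on {0..} (f + g)" unfolding plus_fun_def using f g by (intro continuous_on_add)
    have "average (f + g) = (\<lambda>T. average f T + average g T)"
      unfolding plus_fun_def using f(1) g(1) by (intro ext average_add)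
    then show "(average (f + g) \<longlongrightarrow> 0) at_top" using tendsto_add[OF f(2) g(2)] by simp
  qed
next
  fix f :: "real \<Rightarrow> 'e" assume "f \<in> {f. c_almost_periodic c I f}"
  then show "continuous_on {0..} f \<and> (average f \<longlongrightarrow> 0) at_top"
    using c_ap_continuous_Ici[OF I] c_ap_average_tendsto_0[OF I c] by blast
qed

text \<open>
  The functions of mean value zero form a closed subspace that contains all \<open>c\<close>-almost periodic ones.
\<close>

lemma closed_AP_c0_subset:
  assumes I: "I = UNIV \<or> I = {0..}" and c: "cmod c = 1" "c \<noteq> 1"
  shows "(closed_AP_c0 c I :: (real \<Rightarrow> 'e :: complex_banach) set) \<subseteq> AP_spec (UNIV - {0}) I"
proof
  fix f :: "real \<Rightarrow> 'e" assume "f \<in> closed_AP_c0 c I"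
  then have f: "f \<in> AP I" and approx: "\<And>\<epsilon>. \<epsilon> > 0 \<Longrightarrow> \<exists>g\<in>AP_c0 c I \<inter> AP I. \<forall>t\<in>I. norm (f t - g t) \<le> \<epsilon>"
    unfolding closed_AP_c0_iff[OF I] by blast+
  have contf: "continuous_on {0..} f"
    using c_ap_continuous_Ici[OF I] f unfolding AP_def by blast
  have "(average f \<longlongrightarrow> 0) at_top"
    unfolding tendsto_iff dist_norm diff_0_right
  proof (intro allI impI)
    fix \<epsilon> :: real assume \<epsilon>: "\<epsilon> > 0"
    then have e2: "\<epsilon> / 2 > 0" by simp
    then obtain g where g: "g \<in> AP_c0 c I" "\<forall>t\<in>I. norm (f t - g t) \<le> \<epsilon> / 2"
      using approx by blast
    have contg: "continuous_on {0..} g" and lim: "(average g \<longlongrightarrow> 0) at_top"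
      using AP_c0_average_tendsto_0[OF I c g(1)] by auto
    have "\<forall>\<^sub>F T in at_top. norm (average g T) < \<epsilon> / 2"
      using tendstoD[OF lim e2] by simp
    moreover have "\<forall>\<^sub>F T :: real in at_top. T > 0" by (rule eventually_gt_at_top)
    ultimately show "\<forall>\<^sub>F T in at_top. norm (average f T) < \<epsilon>"
    proof eventually_elim
      case (elim T)
      have "norm (average f T - average g T) \<le> \<epsilon> / 2"
      proof (rule average_diff_bound[OF elim(2)])
        show "continuous_on {0..T} f" "continuous_on {0..T} g"
          by (auto intro: continuous_on_subset[OF contf] continuous_on_subset[OF contg])
      qed (use g(2) half_line_subset[OF I] in auto)
      then show ?case using elim(1) norm_triangle_sub[of "average f T" "average g T"] by simp
    qed
  qed
  then show "f \<in> AP_spec (UNIV - {0}) I" using f by (simp add: AP_spec_nonzero_iff[OF I])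
qed

lemma AP_spec_subset_closed_AP_c0:
  assumes I: "I = UNIV \<or> I = {0..}" and c: "cmod c = 1"
  shows "AP_spec (UNIV - {0}) I \<subseteq> (closed_AP_c0 c I :: (real \<Rightarrow> 'e :: complex_banach) set)"
proof
  fix f :: "real \<Rightarrow> 'e" assume "f \<in> AP_spec (UNIV - {0}) I"
  then have f: "f \<in> AP I" and mean: "(average f \<longlongrightarrow> 0) at_top"
    by (auto simp: AP_spec_nonzero_iff[OF I])
  have "\<exists>g\<in>AP_c0 c I \<inter> AP I. \<forall>t\<in>I. norm (f t - g t) \<le> \<epsilon>" if \<epsilon>: "\<epsilon> > 0" for \<epsilon>
  proof -
    obtain p where p: "p \<in> trig_polynomials (- {0})" "\<forall>t\<in>I. norm (f t - p t) \<le> \<epsilon>"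
      using AP_approximation[OF I f mean \<epsilon>] by (elim bexE)
    define g where "g t = (if t \<in> I then p t else 0)" for t
    have "g \<in> AP_c0 c I"
      unfolding g_def AP_c0_def
    proof (rule trig_polynomials_restrict[OF cfun.subspace_span _ p(1)])
      fix r :: real and v :: 'e assume "r \<in> - {0}"
      then show "(\<lambda>t. if t \<in> I then cis (r * t) *\<^sub>C v else 0) \<in> cfun.span {f. c_almost_periodic c I f}"
        using cis_c_almost_periodic[OF I c] by (intro cfun.span_base) simp
    qed
    moreover have "g \<in> AP I"
      unfolding g_def by (rule trig_polynomials_restrict[OF AP_subspace[OF I] cis_AP[OF I] p(1)])
    moreover have "\<forall>t\<in>I. norm (f t - g t) \<le> \<epsilon>" using p(2) by (simp add: g_def)
    ultimately show ?thesis by blast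
  qed
  then show "f \<in> closed_AP_c0 c I" using f unfolding closed_AP_c0_iff[OF I] by blast
qed

theorem theorem2p24:
  fixes I :: "real set" and c :: complex
  assumes "I = UNIV \<or> I = {0..}"
    and "cmod c = 1"
  shows "(c \<noteq> 1 \<and> Arg c \<in> {pi * q | q. q \<in> \<rat>} \<longrightarrow>
           (closed_AP_c0 c I :: (real \<Rightarrow> 'e :: complex_banach) set) = AP_spec (UNIV - {0}) I) \<and>
         (Arg c \<notin> {pi * q | q. q \<in> \<rat>} \<longrightarrow>
           (closed_AP_c0 c I :: (real \<Rightarrow> 'e) set) \<supseteq> AP_spec (UNIV - {0}) I)"
  using closed_AP_c0_subset[OF assms] AP_spec_subset_closed_AP_c0[OF assms] by blast

end
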